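(* There is a universal constant $C>0$ such that the following holds. Let $n\ge1$, let $\mathcal{U}$ be the uniform probability measure on $[-1,1]$, and let $\{\phi_i\}_{i\ge0}$, with $\phi_0=1$, be an orthonormal basis of $L^2([-1,1],\mathcal{U})$. Let $f,g\in L^2([-1,1]^n,\mathcal{U}^{\otimes n})$ be monotone functions with $\|f\|\le1$ and $\|g\|\le1$. Then $$\mathbb{E}[fg]-\mathbb{E}[f]\,\mathbb{E}[g]\;\ge\;\frac1C\cdot\Phi\left(\sum_{\#\alpha=1}\widehat f(\alpha)\widehat g(\alpha)\right),$$ where the sum is over $\alpha\in\mathbb{N}^n$ with $\#\alpha=1$, expectations are under $\mathcal{U}^{\otimes n}$, and $\Phi:[0,1]\to[0,1]$ is $\Phi(x)=\min\left\{x,\frac{x}{\log^2(1/x)}\right\}$.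
   Context: $\mathbb{N}=\{0,1,2,\dots\}$. $\langle f,g\rangle=\mathbb{E}_{x\sim\mathcal{U}^{\otimes n}}[f(x)g(x)]$, $\|f\|=\langle f,f\rangle^{1/2}$. A function $f:[-1,1]^n\to\mathbb{R}$ is monotone if $f(x)\le f(y)$ whenever $x_i\le y_i$ for all $i\in[n]$. For $\alpha\in\mathbb{N}^n$, $\#\alpha=|\{i:\alpha_i\ne0\}|$, $\phi_\alpha(x)=\prod_{i=1}^n\phi_{\alpha_i}(x_i)$, and $\widehat f(\alpha)=\langle f,\phi_\alpha\rangle$. (An example of such a basis $\{\phi_i\}$ is the normalized Legendre polynomials.) Conventions for $\Phi$: $\Phi(0)=0$, $\Phi(1)=1$. The inequality is read as including that the argument of $\Phi$ lies in its domain $[0,1]$. *)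

theory Defs
  imports "HOL-Probability.Probability"
begin

definition unif :: "real measure" where
  "unif = uniform_measure (lebesgue_on {-1..1}) {-1..1}"

text \<open>Points of $[-1,1]^n$ are functions on the index set \<open>{..<n}\<close>, extensional outside it.
  The product measure is completed, so that arbitrary Lebesgue measurable functions are
  admitted: a monotone function on the cube need not be Borel measurable.\<close>

definition cube_points :: "nat \<Rightarrow> (nat \<Rightarrow> real) set" where
  "cube_points n = {..<n} \<rightarrow>\<^sub>E {-1..1}"

definition cube :: "nat \<Rightarrow> (nat \<Rightarrow> real) measure" where
  "cube n = completion (\<Pi>\<^sub>M i\<in>{..<n}. unif)"

definition square_integrable :: "'a measure \<Rightarrow> ('a \<Rightarrow> real) \<Rightarrow> bool" where
  "square_integrable M f \<longleftrightarrow> f \<in> borel_measurable M \<and> integrable M (\<lambda>x. (f x)\<^sup>2)"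

definition L2_inner :: "'a measure \<Rightarrow> ('a \<Rightarrow> real) \<Rightarrow> ('a \<Rightarrow> real) \<Rightarrow> real" where
  "L2_inner M f g = (LINT x|M. f x * g x)"

definition L2_norm :: "'a measure \<Rightarrow> ('a \<Rightarrow> real) \<Rightarrow> real" where
  "L2_norm M f = sqrt (L2_inner M f f)"

text \<open>An orthonormal basis of $L^2$: an orthonormal sequence whose linear span is dense.\<close>

definition orthonormal_basis :: "'a measure \<Rightarrow> (nat \<Rightarrow> 'a \<Rightarrow> real) \<Rightarrow> bool" where
  "orthonormal_basis M \<phi> \<longleftrightarrow>
     (\<forall>i. square_integrable M (\<phi> i)) \<and>
     (\<forall>i j. L2_inner M (\<phi> i) (\<phi> j) = (if i = j then 1 else 0)) \<and>
     (\<forall>h. square_integrable M h \<longrightarrow>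
        (\<forall>\<epsilon>>0. \<exists>N c. L2_norm M (\<lambda>x. h x - (\<Sum>i<N. c i * \<phi> i x)) < \<epsilon>))"

definition monotone_cube :: "nat \<Rightarrow> ((nat \<Rightarrow> real) \<Rightarrow> real) \<Rightarrow> bool" where
  "monotone_cube n f \<longleftrightarrow> monotone_on (cube_points n) (\<lambda>x y. \<forall>i<n. x i \<le> y i) (\<le>) f"

definition multi_indices :: "nat \<Rightarrow> (nat \<Rightarrow> nat) set" where
  "multi_indices n = {..<n} \<rightarrow>\<^sub>E UNIV"

definition num_nonzero :: "nat \<Rightarrow> (nat \<Rightarrow> nat) \<Rightarrow> nat" where
  "num_nonzero n \<alpha> = card {i. i < n \<and> \<alpha> i \<noteq> 0}"

definition prod_basis :: "(nat \<Rightarrow> real \<Rightarrow> real) \<Rightarrow> nat \<Rightarrow> (nat \<Rightarrow> nat) \<Rightarrow> (nat \<Rightarrow> real) \<Rightarrow> real" where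
  "prod_basis \<phi> n \<alpha> x = (\<Prod>i<n. \<phi> (\<alpha> i) (x i))"

definition fourier_coeff ::
    "(nat \<Rightarrow> real \<Rightarrow> real) \<Rightarrow> nat \<Rightarrow> ((nat \<Rightarrow> real) \<Rightarrow> real) \<Rightarrow> (nat \<Rightarrow> nat) \<Rightarrow> real" where
  "fourier_coeff \<phi> n f \<alpha> = L2_inner (cube n) f (prod_basis \<phi> n \<alpha>)"

text \<open>The explicit case at \<open>1\<close> is needed because division by \<open>ln 1 = 0\<close> gives \<open>0\<close> in HOL,
  whereas the convention is $\Phi(1) = 1$. The logarithm is natural; another base changes
  $\Phi$ by at most a constant factor. Only arguments in $[0,1]$ are meaningful.\<close>

definition Phi :: "real \<Rightarrow> real" where
  "Phi x = (if x = 0 then 0 else if x = 1 then 1 else min x (x / (ln (1 / x))\<^sup>2))"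

lemma space_unif: "space unif = {-1..1}"
  by (simp add: unif_def)

lemma prob_space_unif: "prob_space unif"
  unfolding unif_def
  by (rule prob_space_uniform_measure) (simp_all add: emeasure_restrict_space)

lemma space_cube: "space (cube n) = cube_points n"
  by (simp add: cube_def cube_points_def space_PiM space_unif)

end

theory Submission
  imports Defs
begin

text \<open>For a set \<open>S\<close> of coordinates let \<open>b S\<close> be the expectation of \<open>f x * g y\<close>, where \<open>y\<close>
  agrees with \<open>x\<close> on \<open>S\<close> and is resampled independently elsewhere. Monotonicity makes \<open>b\<close>
  increasing, from \<open>b {} = E[f] E[g]\<close> to \<open>E[fg]\<close>. If every coordinate is kept with probability
  \<open>t\<close>, the average of \<open>b\<close> is a polynomial in \<open>t\<close> whose coefficients are sums of the Moebius
  transform \<open>c\<close> of \<open>b\<close>. For \<open>f = g\<close> one has \<open>c S \<ge> 0\<close>, which gives \<open>\<Sum>S. \<bar>c S\<bar> \<le> 1\<close> for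
  general \<open>f\<close> and \<open>g\<close> by polarization. The linear coefficient is the level-one Fourier sum \<open>a\<close>,
  by Parseval in each coordinate. Minus its constant term, the polynomial is bounded by
  \<open>D = E[fg] - E[f] E[g]\<close> on \<open>[0, 1/2]\<close>, where its part of degree above \<open>d\<close> is at most \<open>2\<close> to the
  power \<open>- d\<close>. A Markov inequality at the end point \<open>0\<close> therefore gives \<open>a \<le> 16 d\<^sup>2 (D + 1 / 2 ^ d)\<close>
  for all \<open>d\<close>, and \<open>d\<close> of order \<open>1 + ln (1 / a)\<close> yields the theorem.\<close>


subsection \<open>A Markov inequality at an end point\<close>

text \<open>With \<open>x = pi * m / N\<close>, multiplying by \<open>2 * sin x\<close> makes the
  sum telescope. The end terms cancel because \<open>2 * x * N\<close> is a multiple of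
  \<open>2 * pi\<close>, and \<open>0 < m < N\<close> keeps \<open>sin x\<close> positive.\<close>

lemma sum_cos_roots_of_unity:
  fixes N m :: nat
  assumes "0 < m" "m < N"
  shows "(\<Sum>j<N. cos (2 * pi * real m / real N * real j)) = 0"
proof -
  define x where "x = pi * real m / real N"
  have s: "2 * sin x * (\<Sum>j<K. cos (2 * x * real j)) = sin (2 * x * real K - x) + sin x" for K
  proof (induction K)
    case (Suc K)
    have "2 * sin x * cos (2 * x * real K) = sin (2 * x * real (Suc K) - x) - sin (2 * x * real K - x)"
      by (simp add: sin_diff sin_add cos_add distrib_left) 
    with Suc show ?case by (simp add: distrib_left)
  qed simp
  have "0 < x" "x < pi" using assms by (auto simp: x_def field_simps)
  hence "sin x > 0" by (rule sin_gt_zero)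
  have "2 * x * real N = 2 * real m * pi" using assms by (simp add: x_def)
  moreover have "sin (2 * real m * pi) = 0" "cos (2 * real m * pi) = 1"
    using sin_2npi[of m] cos_2npi[of m] by (simp_all add: mult_ac)
  ultimately have "sin (2 * x * real N - x) = - sin x"
    by (simp only: sin_diff)
  with s[of N] \<open>sin x > 0\<close> have "(\<Sum>j<N. cos (2 * x * real j)) = 0" by simp
  thus ?thesis by (simp add: x_def mult_ac)
qed

text \<open>With \<open>y = x / 2\<close>, the left side of the double angle formula is twice the
  square of \<open>sin y\<close>, and a third-order Taylor estimate gives the crude bound
  \<open>sin y >= y / 2\<close>.\<close>

lemma one_minus_cos_ge:
  fixes x :: real
  assumes "0 \<le> x" "x \<le> pi"
  shows "x\<^sup>2 / 8 \<le> 1 - cos x"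
proof -
  define y where "y = x / 2"
  have y: "0 \<le> y" "y \<le> 1.6" using assms pi_approx by (auto simp: y_def)
  have "\<bar>sin y - y\<bar> \<le> y ^ 3 / 6"
    using Maclaurin_sin_bound[of y 3] y
    by (simp add: sin_coeff_def numeral_eq_Suc fact_numeral)
  moreover have "y ^ 3 \<le> 3 * y"
  proof -
    have "y * y \<le> 1.6 * 1.6" using y by (intro mult_mono) auto
    hence "y * (y * y) \<le> y * 3" using y by (intro mult_left_mono) auto
    thus ?thesis by (simp add: power3_eq_cube)
  qed
  ultimately have "y / 2 \<le> sin y" by linarith
  hence "(y/2)\<^sup>2 \<le> (sin y)\<^sup>2" using y by (intro power_mono) auto
  moreover have "cos x = 1 - 2 * (sin y)\<^sup>2" using cos_double_sin[of y] by (simp add: y_def)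
  ultimately show ?thesis by (simp add: y_def power2_eq_square)
qed

lemma sum_inverse_squares_le:
  "(\<Sum>j=1..n. 1 / (real j)\<^sup>2) \<le> 2"
proof -
  \<comment> \<open>Subtracting the remainder of the telescoping comparison series makes the bound
    inductive.\<close>
  have "(\<Sum>j=1..Suc n. 1 / (real j)\<^sup>2) \<le> 2 - 1 / real (Suc n)" for n
  proof (induction n)
    case (Suc n)
    have "1 / (real (Suc (Suc n)))\<^sup>2 \<le> 1 / (real (Suc n) * real (Suc (Suc n)))"
      by (intro divide_left_mono) (auto simp: power2_eq_square mult_right_mono)
    also have "\<dots> = 1 / real (Suc n) - 1 / real (Suc (Suc n))" by (simp add: field_simps)
    finally show ?case using Suc by simp
  qed simp
  from this[of "n - 1"] show ?thesis
    by (cases n) (auto intro: order_trans)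
qed

text \<open>The points \<open>cos (cheb_node d j)\<close> are those where the Chebyshev polynomial
  of degree \<open>d\<close> takes the values \<open>(-1) ^ j\<close>. Letting \<open>j\<close> run
  through a full period counts the points inside (-1,1) twice, but turns the sums into discrete
  Fourier sums.\<close>

definition cheb_node :: "nat \<Rightarrow> nat \<Rightarrow> real" where
  "cheb_node d j = pi * real j / real d"

text \<open>The denominator cancels the factor \<open>1 - cos x\<close> that a second difference of
  \<open>cos (k x)\<close> in \<open>k\<close> produces.\<close>

definition cheb_weight :: "nat \<Rightarrow> nat \<Rightarrow> real" where
  "cheb_weight d j = (-1) ^ j / (1 - cos (cheb_node d j))"

text \<open>On functions of the form \<open>q (cos x)\<close> with \<open>q\<close> a polynomial of degree at most \<open>d\<close>,
  this functional is the derivative of \<open>q\<close> at \<open>1\<close>: it sends \<open>cos (k x)\<close> to \<open>k\<^sup>2\<close>. The weight at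
  the node \<open>0\<close> is omitted by subtracting \<open>h 0\<close>.\<close>

definition cheb_functional :: "nat \<Rightarrow> (real \<Rightarrow> real) \<Rightarrow> real" where
  "cheb_functional d h = (\<Sum>j\<in>{1..<2*d}. cheb_weight d j * (h (cheb_node d j) - h 0))"

lemma cos_cheb_node_less_1:
  assumes "j \<in> {1..<2*d}"
  shows "cos (cheb_node d j) < 1"
proof (cases "j \<le> d")
  case True
  then show ?thesis using assms cos_monotone_0_pi[of 0 "cheb_node d j"]
    by (auto simp: cheb_node_def field_simps)
next
  case False
  have "cos (cheb_node d j) = cos (2 * pi - cheb_node d j)" by (simp add: cos_diff)
  moreover have "0 < 2 * pi - cheb_node d j" "2 * pi - cheb_node d j \<le> pi"
    using assms False by (auto simp: cheb_node_def field_simps)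
  ultimately show ?thesis using cos_monotone_0_pi[of 0 "2 * pi - cheb_node d j"] by auto
qed

text \<open>For \<open>j <= d\<close>, \<open>one_minus_cos_ge\<close> and the fact that the square
  of \<open>pi\<close> exceeds 8 give the first summand alone; for larger \<open>j\<close>,
  reflection to \<open>2 * pi - cheb_node d j\<close> gives the second. Keeping both summands avoids
  splitting the sum over \<open>j\<close> later.\<close>

lemma abs_cheb_weight_le:
  assumes "j \<in> {1..<2*d}"
  shows "\<bar>cheb_weight d j\<bar> \<le> (real d)\<^sup>2 * (1 / (real j)\<^sup>2 + 1 / (real (2*d - j))\<^sup>2)"
proof -
  have aux: "1 / (1 - c) \<le> (real d)\<^sup>2 * (1 / (real i)\<^sup>2)"
    if "0 < i" "i \<le> d" "c = cos (pi * real i / real d)" for i c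
  proof -
    have d: "d > 0" using that by simp
    have "(real i / real d)\<^sup>2 * 8 \<le> (real i / real d)\<^sup>2 * pi\<^sup>2"
    proof (intro mult_left_mono)
      have "3 * 3 \<le> pi * pi" using pi_approx by (intro mult_mono) auto
      thus "8 \<le> pi\<^sup>2" by (simp add: power2_eq_square)
    qed simp
    hence "(real i / real d)\<^sup>2 \<le> (pi * (real i / real d))\<^sup>2 / 8"
      by (simp only: power_mult_distrib mult.commute[of "pi\<^sup>2"])
    also have "\<dots> \<le> 1 - cos (pi * (real i / real d))"
      using that by (intro one_minus_cos_ge) (auto simp: field_simps)
    also have "\<dots> = 1 - c" using that by simp
    finally have "(real i / real d)\<^sup>2 \<le> 1 - c" .
    moreover have "0 < (real i / real d)\<^sup>2" using that d by simp
    ultimately have "1 / (1 - c) \<le> 1 / (real i / real d)\<^sup>2"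
      by (intro frac_le) auto
    thus ?thesis by (simp add: power_divide)
  qed
  have abs: "\<bar>cheb_weight d j\<bar> = 1 / (1 - cos (cheb_node d j))"
    using cos_cheb_node_less_1[OF assms] by (simp add: cheb_weight_def abs_mult power_abs)
  show ?thesis
  proof (cases "j \<le> d")
    case True
    have "\<bar>cheb_weight d j\<bar> \<le> (real d)\<^sup>2 * (1 / (real j)\<^sup>2)"
      unfolding abs using assms True by (intro aux) (auto simp: cheb_node_def)
    also have "\<dots> \<le> (real d)\<^sup>2 * (1 / (real j)\<^sup>2 + 1 / (real (2*d - j))\<^sup>2)"
      by (intro mult_left_mono) auto
    finally show ?thesis .
  next
    case False
    have "cos (cheb_node d j) = cos (2 * pi - cheb_node d j)" by (simp add: cos_diff)
    also have "2 * pi - cheb_node d j = pi * real (2*d - j) / real d"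
      using assms by (auto simp: cheb_node_def field_simps of_nat_diff)
    finally have "\<bar>cheb_weight d j\<bar> \<le> (real d)\<^sup>2 * (1 / (real (2*d - j))\<^sup>2)"
      unfolding abs using assms False by (intro aux) auto
    also have "\<dots> \<le> (real d)\<^sup>2 * (1 / (real j)\<^sup>2 + 1 / (real (2*d - j))\<^sup>2)"
      by (intro mult_left_mono) auto
    finally show ?thesis .
  qed
qed

lemma sum_abs_cheb_weight_le: "(\<Sum>j\<in>{1..<2*d}. \<bar>cheb_weight d j\<bar>) \<le> 4 * (real d)\<^sup>2"
proof -
  have "(\<Sum>j\<in>{1..<2*d}. \<bar>cheb_weight d j\<bar>)
      \<le> (\<Sum>j\<in>{1..<2*d}. (real d)\<^sup>2 * (1 / (real j)\<^sup>2 + 1 / (real (2*d - j))\<^sup>2))"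
    by (intro sum_mono abs_cheb_weight_le)
  also have "\<dots> = (real d)\<^sup>2 * ((\<Sum>j\<in>{1..<2*d}. 1 / (real j)\<^sup>2) + (\<Sum>j\<in>{1..<2*d}. 1 / (real (2*d - j))\<^sup>2))"
    by (simp only: sum_distrib_left sum.distrib distrib_left)
  also have "(\<Sum>j\<in>{1..<2*d}. 1 / (real (2*d - j))\<^sup>2) = (\<Sum>j\<in>{1..<2*d}. 1 / (real j)\<^sup>2)"
    by (rule sum.reindex_bij_witness[of _ "\<lambda>j. 2*d - j" "\<lambda>j. 2*d - j"]) auto
  also have "{1..<2*d} = {1..2*d-1}" by auto
  also have "(real d)\<^sup>2 * ((\<Sum>j=1..2*d-1. 1 / (real j)\<^sup>2) + (\<Sum>j=1..2*d-1. 1 / (real j)\<^sup>2))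
      \<le> (real d)\<^sup>2 * (2 + 2)"
    by (intro mult_left_mono add_mono sum_inverse_squares_le) simp
  finally show ?thesis by (simp only: \<open>{1..<2*d} = {1..2*d-1}\<close>) simp
qed

text \<open>The second difference of \<open>cos (k x)\<close> in \<open>k\<close> is
  \<open>-2 (1 - cos x) cos (k x)\<close>. The weight cancels \<open>1 - cos x\<close>, and the
  alternating cosine sum that is left would vanish if node \<open>0\<close> were included; its
  omission produces the final \<open>2\<close>. The frequency \<open>real k - 1\<close> may be
  \<open>-1\<close>, so \<open>k = 0\<close> is covered.\<close>

lemma cheb_functional_cos_step:
  assumes "k < d"
  shows "cheb_functional d (\<lambda>x. cos (real (k+1) * x)) + cheb_functional d (\<lambda>x. cos ((real k - 1) * x))
     = 2 * cheb_functional d (\<lambda>x. cos (real k * x)) + 2"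
proof -
  have d: "d > 0" using assms by simp
  have eq: "cheb_weight d j * (cos (real (k+1) * cheb_node d j) - 1) + cheb_weight d j * (cos ((real k - 1) * cheb_node d j) - 1)
      = 2 * (cheb_weight d j * (cos (real k * cheb_node d j) - 1))
        + 2 * cheb_weight d j * (1 - cos (real k * cheb_node d j) * (1 - cos (cheb_node d j)) - 1)" for j
    by (simp add: distrib_right left_diff_distrib cos_add cos_diff algebra_simps)
  have eq2: "2 * cheb_weight d j * (1 - cos (real k * cheb_node d j) * (1 - cos (cheb_node d j)) - 1)
      = - 2 * cos (2 * pi * real (k + d) / real (2 * d) * real j)" if "j \<in> {1..<2*d}" for j
  proof -
    \<comment> \<open>The sign \<open>(-1) ^ j = cos (pi * j)\<close> amounts to a frequency shift
      by \<open>d\<close> out of \<open>2 * d\<close>; with \<open>k < d\<close>, the shifted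
      frequency lies strictly between \<open>0\<close> and \<open>2 * d\<close>.\<close>
    have "2 * pi * real (k + d) / real (2 * d) * real j = real k * cheb_node d j + pi * real j"
      using d by (simp add: cheb_node_def field_simps)
    hence "cos (2 * pi * real (k + d) / real (2 * d) * real j) = cos (real k * cheb_node d j) * (-1) ^ j"
      by (simp add: cos_add)
    thus ?thesis using cos_cheb_node_less_1[OF that] by (simp add: cheb_weight_def)
  qed
  have "cheb_functional d (\<lambda>x. cos (real (k+1) * x)) + cheb_functional d (\<lambda>x. cos ((real k - 1) * x))
     = 2 * cheb_functional d (\<lambda>x. cos (real k * x)) 
       + (\<Sum>j\<in>{1..<2*d}. - 2 * cos (2 * pi * real (k + d) / real (2 * d) * real j))"
    unfolding cheb_functional_def sum_distrib_left sum.distrib[symmetric]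
    by (intro sum.cong refl, subst eq2[symmetric], assumption) (use eq in simp)
  also have "(\<Sum>j\<in>{1..<2*d}. - 2 * cos (2 * pi * real (k + d) / real (2 * d) * real j))
      = - 2 * ((\<Sum>j<2*d. cos (2 * pi * real (k + d) / real (2 * d) * real j)) - 1)"
  proof -
    have "{..<2*d} = insert 0 {1..<2*d}" using d by auto
    thus ?thesis by (simp add: sum_distrib_left)
  qed
  also have "(\<Sum>j<2*d. cos (2 * pi * real (k + d) / real (2 * d) * real j)) = 0"
    using assms by (intro sum_cos_roots_of_unity) auto
  finally show ?thesis by simp
qed

text \<open>Squares solve the recurrence of \<open>cheb_functional_cos_step\<close>. At its start
  \<open>k = 0\<close> both outer frequencies are \<open>1\<close> up to sign, which yields the
  value at \<open>1\<close>.\<close>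

lemma cheb_functional_cos:
  "k \<le> d \<Longrightarrow> cheb_functional d (\<lambda>x. cos (real k * x)) = (real k)\<^sup>2"
proof (induction k rule: less_induct)
  case (less k)
  consider "k = 0" | "k = 1" | l where "k = Suc (Suc l)"
    by (cases k; cases "k - 1") auto
  thus ?case
  proof cases
    case 1
    thus ?thesis by (simp add: cheb_functional_def)
  next
    case 2
    thus ?thesis using cheb_functional_cos_step[of 0 d] less.prems
      by (simp add: cheb_functional_def)
  next
    case 3
    have "(real (Suc l) - 1) = real l" by simp
    hence "cheb_functional d (\<lambda>x. cos (real k * x)) + (real l)\<^sup>2 = 2 * (real (Suc l))\<^sup>2 + 2"
      using cheb_functional_cos_step[of "Suc l" d] less.prems less.IH[of "Suc l"] less.IH[of l] 3
      by simp
    thus ?thesis using 3 by (simp add: power2_eq_square algebra_simps)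
  qed
qed

lemma cheb_functional_linear:
  "cheb_functional d (\<lambda>x. a * h x + b * h' x) = a * cheb_functional d h + b * cheb_functional d h'"
  unfolding cheb_functional_def
  by (simp add: sum_distrib_left algebra_simps flip: sum.distrib)

text \<open>Multiplication by \<open>1 - cos x\<close> is minus half a second difference in
  \<open>k\<close>. Applied to the square of \<open>k\<close> it gives the constant
  \<open>-1\<close>, and from then on \<open>0\<close>; each step raises the highest frequency by
  one, hence the condition on \<open>m + k\<close>.\<close>

lemma cheb_functional_pow_cos:
  assumes "m + k \<le> d"
  shows "cheb_functional d (\<lambda>x. (1 - cos x) ^ m * cos (real k * x))
    = (if m = 0 then (real k)\<^sup>2 else if m = 1 then -1 else 0)"
  using assms
proof (induction m arbitrary: k)
  case 0
  thus ?case by (simp add: cheb_functional_cos)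
next
  case (Suc m)
  \<comment> \<open>The absolute value of \<open>k - 1\<close>, as cosine is even.\<close>
  define k' where "k' = (if k = 0 then 1 else k - 1)"
  have k': "cos ((real k - 1) * x) = cos (real k' * x)" for x
    by (cases k) (auto simp: k'_def)
  have sq: "(real k')\<^sup>2 + (real (k+1))\<^sup>2 = 2 * (real k)\<^sup>2 + 2"
    by (cases k) (auto simp: k'_def power2_eq_square algebra_simps)
  have "(1 - cos x) ^ Suc m * cos (real k * x)
     = 1 * ((1 - cos x) ^ m * cos (real k * x)) + (-1/2) * (1 * ((1 - cos x) ^ m * cos (real (k+1) * x))
       + 1 * ((1 - cos x) ^ m * cos (real k' * x)))" for x
    unfolding k'[symmetric] by (simp add: distrib_right left_diff_distrib cos_add cos_diff algebra_simps)
  hence "cheb_functional d (\<lambda>x. (1 - cos x) ^ Suc m * cos (real k * x))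
    = cheb_functional d (\<lambda>x. (1 - cos x) ^ m * cos (real k * x))
      + (-1/2) * (cheb_functional d (\<lambda>x. (1 - cos x) ^ m * cos (real (k+1) * x))
                  + cheb_functional d (\<lambda>x. (1 - cos x) ^ m * cos (real k' * x)))"
    using cheb_functional_linear[of d 1 "\<lambda>x. (1 - cos x) ^ m * cos (real k * x)" "-1/2"
        "\<lambda>x. 1 * ((1 - cos x) ^ m * cos (real (k+1) * x)) + 1 * ((1 - cos x) ^ m * cos (real k' * x))"]
      cheb_functional_linear[of d 1 "\<lambda>x. (1 - cos x) ^ m * cos (real (k+1) * x)" 1
        "\<lambda>x. (1 - cos x) ^ m * cos (real k' * x)"] by (simp only: mult_1)
  moreover have "m + k \<le> d" "m + (k+1) \<le> d" "m + k' \<le> d" using Suc.prems by (auto simp: k'_def)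
  ultimately show ?case using Suc.IH[of k] Suc.IH[of "k+1"] Suc.IH[of k'] sq
    by (auto simp: field_simps)
qed

lemma cheb_functional_sum:
  "finite A \<Longrightarrow> cheb_functional d (\<lambda>x. \<Sum>k\<in>A. h k x) = (\<Sum>k\<in>A. cheb_functional d (h k))"
proof (induction A rule: finite_induct)
  case empty
  show ?case by (simp add: cheb_functional_def)
next
  case (insert k A)
  thus ?case using cheb_functional_linear[of d 1 "h k" 1 "\<lambda>x. \<Sum>k\<in>A. h k x"] by simp
qed

text \<open>The substitution \<open>t = (1 - cos x) / 4\<close> stays in [0,1/2]. Among the powers
  of \<open>t\<close>, \<open>cheb_functional\<close> sees only the linear one and returns
  \<open>- a 1 / 4\<close>, while the weights add up to at most 4 times the square of
  \<open>d\<close> in absolute value.\<close>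

lemma markov_endpoint:
  fixes a :: "nat \<Rightarrow> real"
  assumes "d \<ge> 1" and bound: "\<And>t. 0 \<le> t \<Longrightarrow> t \<le> 1/2 \<Longrightarrow> \<bar>\<Sum>k=1..d. a k * t ^ k\<bar> \<le> M"
  shows "\<bar>a 1\<bar> \<le> 16 * (real d)\<^sup>2 * M"
proof -
  define h where "h = (\<lambda>x. \<Sum>k=1..d. a k * ((1 - cos x) / 4) ^ k)"
  have "h = (\<lambda>x. \<Sum>k=1..d. (a k / 4 ^ k) * (1 - cos x) ^ k)"
    by (simp add: h_def power_divide)
  hence "cheb_functional d h = (\<Sum>k=1..d. cheb_functional d (\<lambda>x. (a k / 4 ^ k) * (1 - cos x) ^ k))"
    by (simp only: cheb_functional_sum finite_atLeastAtMost)
  also have "\<dots> = (\<Sum>k=1..d. a k / 4 ^ k * (if k = 1 then -1 else 0))"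
  proof (intro sum.cong refl)
    fix k assume "k \<in> {1..d}"
    thus "cheb_functional d (\<lambda>x. (a k / 4 ^ k) * (1 - cos x) ^ k) = a k / 4 ^ k * (if k = 1 then -1 else 0)"
      using cheb_functional_linear[of d "a k / 4 ^ k" "\<lambda>x. (1 - cos x) ^ k" 0 "\<lambda>_. 0"]
        cheb_functional_pow_cos[of k 0 d] by auto
  qed
  also have "\<dots> = (\<Sum>k=1..d. if k = 1 then - a 1 / 4 else 0)"
    by (intro sum.cong) auto
  also have "\<dots> = - a 1 / 4" using \<open>d \<ge> 1\<close> by simp
  finally have "\<bar>a 1\<bar> = 4 * \<bar>cheb_functional d h\<bar>" by simp
  moreover have "h 0 = 0" by (simp add: h_def)
  hence "\<bar>cheb_functional d h\<bar> \<le> (\<Sum>j\<in>{1..<2*d}. \<bar>cheb_weight d j\<bar> * \<bar>h (cheb_node d j)\<bar>)"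
    unfolding cheb_functional_def by (intro order_trans[OF sum_abs]) (simp add: abs_mult)
  moreover have "\<dots> \<le> (\<Sum>j\<in>{1..<2*d}. \<bar>cheb_weight d j\<bar> * M)"
    unfolding h_def
  proof (intro sum_mono mult_left_mono bound)
    show "(1 - cos (cheb_node d j)) / 4 \<le> 1 / 2" for j
    proof -
      have "(1 - c) / 4 \<le> 1 / 2" if "-1 \<le> c" for c :: real using that by simp
      thus ?thesis using cos_ge_minus_one .
    qed
  qed auto
  \<comment> \<open>Here \<open>bound[of 0]\<close> supplies \<open>0 <= M\<close>.\<close>
  moreover have "\<dots> \<le> 4 * (real d)\<^sup>2 * M"
    using bound[of 0] sum_abs_cheb_weight_le[of d]
    by (auto simp flip: sum_distrib_right intro: mult_right_mono)
  ultimately show ?thesis by linarith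
qed

subsection \<open>Monotone set functions with small Moebius transform\<close>

definition subset_moebius :: "('a set \<Rightarrow> real) \<Rightarrow> 'a set \<Rightarrow> real" where
  "subset_moebius b S = (\<Sum>T\<in>Pow S. (-1) ^ card (S - T) * b T)"

lemma sum_subset_moebius:
  assumes "finite S"
  shows "(\<Sum>T\<in>Pow S. subset_moebius b T) = b S"
proof -
  \<comment> \<open>The factor \<open>(-1) ^ card T\<close> brings the transform into the
    self-inverse form of \<open>inclusion_exclusion_symmetric\<close>.\<close>
  have eq: "(-1) ^ card T * subset_moebius b T = (\<Sum>U\<in>Pow T. (-1) ^ card U * b U)" if "finite T" for T
    unfolding subset_moebius_def sum_distrib_left
  proof (intro sum.cong refl)
    fix U assume "U \<in> Pow T"
    hence "card T = card (T - U) + card U" 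
      using that by (simp add: card_Diff_subset card_mono finite_subset)
    hence "(-1::real) ^ card T * (-1) ^ card (T - U) = (-1) ^ card U"
      by (simp add: power_add)
    thus "(-1) ^ card T * ((-1) ^ card (T - U) * b U) = (-1) ^ card U * b U"
      by (simp flip: mult.assoc)
  qed
  have "b S = (\<Sum>T\<in>Pow S. (-1) ^ card T * ((-1) ^ card T * subset_moebius b T))"
    by (rule inclusion_exclusion_symmetric[OF eq assms])
  also have "\<dots> = (\<Sum>T\<in>Pow S. subset_moebius b T)" by (simp flip: mult.assoc)
  finally show ?thesis ..
qed

lemma sum_Pow_binomial_weights:
  fixes r :: real
  assumes "finite V"
  shows "(\<Sum>S\<in>Pow V. r ^ card S * (1 - r) ^ card (V - S)) = 1"
  using prod_add[OF assms, of "\<lambda>_. r" "\<lambda>_. 1 - r"] by simp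

text \<open>Writing \<open>S\<close> as \<open>T\<close> together with a free subset
  \<open>U\<close> of \<open>V - T\<close> splits off the factor \<open>r ^ card T\<close>, the
  probability that the random set includes \<open>T\<close>.\<close>

lemma sum_Pow_binomial_weights_superset:
  fixes r :: real
  assumes "finite V" "T \<subseteq> V"
  shows "(\<Sum>S\<in>{S\<in>Pow V. T \<subseteq> S}. r ^ card S * (1 - r) ^ card (V - S)) = r ^ card T"
proof -
  have fT: "finite T" using assms finite_subset by blast
  have "(\<Sum>S\<in>{S\<in>Pow V. T \<subseteq> S}. r ^ card S * (1 - r) ^ card (V - S))
      = (\<Sum>U\<in>Pow (V - T). r ^ card (T \<union> U) * (1 - r) ^ card ((V - T) - U))"
    by (rule sum.reindex_bij_witness[of _ "\<lambda>U. T \<union> U" "\<lambda>S. S - T"])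
      (use assms in \<open>auto intro!: arg_cong2[where f = "(*)"] arg_cong[where f = "\<lambda>S. _ ^ card S"]\<close>)
  also have "\<dots> = (\<Sum>U\<in>Pow (V - T). r ^ card T * (r ^ card U * (1 - r) ^ card ((V - T) - U)))"
  proof (intro sum.cong refl)
    fix U assume U: "U \<in> Pow (V - T)"
    have "card (T \<union> U) = card T + card U"
      using U assms fT by (intro card_Un_disjoint) (auto intro: finite_subset)
    thus "r ^ card (T \<union> U) * (1 - r) ^ card ((V - T) - U)
        = r ^ card T * (r ^ card U * (1 - r) ^ card ((V - T) - U))"
      by (simp add: power_add)
  qed
  also have "\<dots> = r ^ card T"
    using assms by (simp add: sum_Pow_binomial_weights flip: sum_distrib_left)
  finally show ?thesis .
qed

lemma subset_moebius_singleton: "subset_moebius b {i} = b {i} - b {}"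
  by (simp add: subset_moebius_def Pow_insert)

text \<open>The polynomial with coefficients \<open>subset_moebius b S\<close> interpolates between \<open>b {}\<close> and \<open>b V\<close>;
  its value at \<open>r\<close> is the average of \<open>b\<close> over a random set containing each point
  independently with probability \<open>r\<close>.\<close>

lemma sum_subset_moebius_power:
  assumes "finite V"
  shows "(\<Sum>S\<in>Pow V. subset_moebius b S * r ^ card S)
    = (\<Sum>S\<in>Pow V. r ^ card S * (1 - r) ^ card (V - S) * b S)"
proof -
  have "(\<Sum>S\<in>Pow V. r ^ card S * (1 - r) ^ card (V - S) * b S)
      = (\<Sum>S\<in>Pow V. \<Sum>T\<in>{T\<in>Pow V. T \<subseteq> S}. r ^ card S * (1 - r) ^ card (V - S) * subset_moebius b T)"
  proof (intro sum.cong refl)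
    fix S assume S: "S \<in> Pow V"
    hence "{T\<in>Pow V. T \<subseteq> S} = Pow S" "finite S" using assms finite_subset by auto
    thus "r ^ card S * (1 - r) ^ card (V - S) * b S
        = (\<Sum>T\<in>{T\<in>Pow V. T \<subseteq> S}. r ^ card S * (1 - r) ^ card (V - S) * subset_moebius b T)"
      by (simp add: sum_subset_moebius flip: sum_distrib_left)
  qed
  also have "\<dots> = (\<Sum>T\<in>Pow V. \<Sum>S\<in>{S\<in>Pow V. T \<subseteq> S}. r ^ card S * (1 - r) ^ card (V - S) * subset_moebius b T)"
    using assms by (intro sum.swap_restrict) auto
  also have "\<dots> = (\<Sum>T\<in>Pow V. subset_moebius b T * r ^ card T)"
  proof (intro sum.cong refl)
    fix T assume "T \<in> Pow V"
    hence "(\<Sum>S\<in>{S\<in>Pow V. T \<subseteq> S}. r ^ card S * (1 - r) ^ card (V - S)) = r ^ card T"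
      using assms by (intro sum_Pow_binomial_weights_superset) auto
    thus "(\<Sum>S\<in>{S\<in>Pow V. T \<subseteq> S}. r ^ card S * (1 - r) ^ card (V - S) * subset_moebius b T)
        = subset_moebius b T * r ^ card T"
      unfolding sum_distrib_right[symmetric] by simp
  qed
  finally show ?thesis ..
qed

text \<open>By \<open>sum_subset_moebius_power\<close> the full polynomial at \<open>t\<close> is an
  average of \<open>b\<close>, so it exceeds \<open>b {}\<close> by at least 0 and at most
  \<open>b V - b {}\<close>. For \<open>t <= 1/2\<close> the terms of degree above \<open>d\<close>
  total at most \<open>(1/2) ^ d\<close>. Removing them leaves a polynomial to which
  \<open>markov_endpoint\<close> applies.\<close>

lemma level_one_le:
  assumes V: "finite V" and d: "d \<ge> 1"
    and lower: "\<And>S. S \<subseteq> V \<Longrightarrow> b {} \<le> b S" and upper: "\<And>S. S \<subseteq> V \<Longrightarrow> b S \<le> b V"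
    and sum_le: "(\<Sum>S\<in>Pow V. \<bar>subset_moebius b S\<bar>) \<le> 1"
  shows "(\<Sum>i\<in>V. b {i} - b {}) \<le> 16 * (real d)\<^sup>2 * (b V - b {} + (1/2) ^ d)"
proof -
  define a where "a k = (\<Sum>S | S \<in> Pow V \<and> card S = k. subset_moebius b S)" for k
  have bound: "\<bar>\<Sum>k=1..d. a k * t ^ k\<bar> \<le> b V - b {} + (1/2) ^ d" if t: "0 \<le> t" "t \<le> 1/2" for t
  proof -
    let ?w = "\<lambda>S. t ^ card S * (1 - t) ^ card (V - S)"
    have w: "?w S \<ge> 0" for S using t by simp
    have "(\<Sum>k=1..d. a k * t ^ k) = (\<Sum>k=1..d. \<Sum>S | S \<in> Pow V \<and> card S = k. subset_moebius b S * t ^ card S)"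
      by (simp add: a_def sum_distrib_right)
    also have "\<dots> = (\<Sum>S | S \<in> Pow V \<and> card S \<in> {1..d}. subset_moebius b S * t ^ card S)"
      using V by (subst sum.group[symmetric, of _ "{1..d}" card])
        (auto intro!: sum.cong)
    finally have low: "(\<Sum>k=1..d. a k * t ^ k) = (\<Sum>S | S \<in> Pow V \<and> card S \<in> {1..d}. subset_moebius b S * t ^ card S)" .
    have split: "Pow V = {{}} \<union> {S. S \<in> Pow V \<and> card S \<in> {1..d}} \<union> {S. S \<in> Pow V \<and> card S > d}"
      using V by (auto simp: not_less Suc_le_eq card_gt_0_iff finite_subset)
    have "(\<Sum>S\<in>Pow V. subset_moebius b S * t ^ card S)
        = b {} + (\<Sum>k=1..d. a k * t ^ k) + (\<Sum>S | S \<in> Pow V \<and> card S > d. subset_moebius b S * t ^ card S)"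
      unfolding low using V d
      by (subst split, subst sum.union_disjoint, simp, simp, force, subst sum.union_disjoint)
        (auto simp: subset_moebius_def)
    hence "(\<Sum>k=1..d. a k * t ^ k) = ((\<Sum>S\<in>Pow V. ?w S * b S) - b {})
        - (\<Sum>S | S \<in> Pow V \<and> card S > d. subset_moebius b S * t ^ card S)"
      using sum_subset_moebius_power[OF V, of b t] by simp
    moreover have "\<bar>(\<Sum>S\<in>Pow V. ?w S * b S) - b {}\<bar> \<le> b V - b {}"
    proof -
      have "(\<Sum>S\<in>Pow V. ?w S * b {}) \<le> (\<Sum>S\<in>Pow V. ?w S * b S)"
        using lower w by (intro sum_mono mult_left_mono) auto
      moreover have "(\<Sum>S\<in>Pow V. ?w S * b S) \<le> (\<Sum>S\<in>Pow V. ?w S * b V)"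
        using upper w by (intro sum_mono mult_left_mono) auto
      ultimately show ?thesis
        using sum_Pow_binomial_weights[OF V, of t] by (simp flip: sum_distrib_right)
    qed
    moreover have "\<bar>\<Sum>S | S \<in> Pow V \<and> card S > d. subset_moebius b S * t ^ card S\<bar> \<le> (1/2) ^ d"
    proof -
      have "t ^ k \<le> (1/2) ^ d" if "k > d" for k
      proof -
        have "t ^ k \<le> (1/2) ^ k" using t by (intro power_mono) auto
        also have "\<dots> \<le> (1/2) ^ d" using that by (intro power_decreasing) auto
        finally show ?thesis .
      qed
      hence "\<bar>\<Sum>S | S \<in> Pow V \<and> card S > d. subset_moebius b S * t ^ card S\<bar>
          \<le> (\<Sum>S | S \<in> Pow V \<and> card S > d. \<bar>subset_moebius b S\<bar> * (1/2) ^ d)"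
        using t by (intro order_trans[OF sum_abs] sum_mono) (auto simp: abs_mult intro!: mult_left_mono)
      also have "\<dots> = (\<Sum>S | S \<in> Pow V \<and> card S > d. \<bar>subset_moebius b S\<bar>) * (1/2) ^ d"
        by (simp add: sum_distrib_right)
      also have "\<dots> \<le> 1 * (1/2) ^ d"
        using V by (intro mult_right_mono order_trans[OF sum_mono2 sum_le]) auto
      finally show ?thesis by simp
    qed
    ultimately show ?thesis by linarith
  qed
  have "(\<Sum>i\<in>V. b {i} - b {}) = (\<Sum>i\<in>V. subset_moebius b {i})" by (simp add: subset_moebius_singleton)
  also have "\<dots> = a 1" unfolding a_def
    by (rule sum.reindex_bij_witness[of _ the_elem "\<lambda>i. {i}"]) (auto simp: card_1_singleton_iff)
  also have "\<dots> \<le> 16 * (real d)\<^sup>2 * (b V - b {} + (1/2) ^ d)"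
    using markov_endpoint[OF d bound] by linarith
  finally show ?thesis .
qed

text \<open>The increments are the Moebius coefficients of singletons, hence part of the bounded
  total. This keeps the argument of \<open>Phi\<close> at most 1.\<close>

lemma level_one_le_1:
  assumes V: "finite V" and sum_le: "(\<Sum>S\<in>Pow V. \<bar>subset_moebius b S\<bar>) \<le> 1"
  shows "(\<Sum>i\<in>V. b {i} - b {}) \<le> 1"
proof -
  have "(\<Sum>i\<in>V. b {i} - b {}) \<le> (\<Sum>i\<in>V. \<bar>subset_moebius b {i}\<bar>)" 
    by (intro sum_mono) (simp add: subset_moebius_singleton)
  also have "\<dots> = (\<Sum>S\<in>(\<lambda>i. {i}) ` V. \<bar>subset_moebius b S\<bar>)" by (subst sum.reindex) auto
  also have "\<dots> \<le> (\<Sum>S\<in>Pow V. \<bar>subset_moebius b S\<bar>)" using V by (intro sum_mono2) auto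
  finally show ?thesis using sum_le by simp
qed

subsection \<open>Correlations of partially resampled points\<close>

lemma square_integrable_measurable: "square_integrable M f \<Longrightarrow> f \<in> borel_measurable M"
  by (simp add: square_integrable_def)

lemma square_integrable_prod:
  assumes "square_integrable M f" "square_integrable M g"
  shows "integrable M (\<lambda>x. f x * g x)"
proof (rule Bochner_Integration.integrable_bound)
  show "integrable M (\<lambda>x. (f x)\<^sup>2 + (g x)\<^sup>2)" "(\<lambda>x. f x * g x) \<in> borel_measurable M"
    using assms by (auto simp: square_integrable_def)
  have "\<bar>f x * g x\<bar> \<le> (f x)\<^sup>2 + (g x)\<^sup>2" for x
  proof -
    have "\<bar>f x * g x\<bar> \<le> 2 * \<bar>f x\<bar> * \<bar>g x\<bar>" by (simp add: abs_mult)
    also have "\<dots> \<le> (f x)\<^sup>2 + (g x)\<^sup>2" using sum_squares_bound[of "\<bar>f x\<bar>" "\<bar>g x\<bar>"] by simp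
    finally show ?thesis .
  qed
  thus "AE x in M. norm (f x * g x) \<le> norm ((f x)\<^sup>2 + (g x)\<^sup>2)" by auto
qed

lemma square_integrable_add:
  assumes "square_integrable M f" "square_integrable M g"
  shows "square_integrable M (\<lambda>x. f x + g x)"
  using assms square_integrable_prod[OF assms]
  by (auto simp: square_integrable_def power2_sum mult.assoc)

lemma square_integrable_cmult:
  assumes "square_integrable M f"
  shows "square_integrable M (\<lambda>x. c * f x)"
  using assms by (auto simp: square_integrable_def power_mult_distrib)

lemma square_integrable_sum:
  assumes "finite A" "\<And>i. i \<in> A \<Longrightarrow> square_integrable M (f i)"
  shows "square_integrable M (\<lambda>x. \<Sum>i\<in>A. f i x)"
  using assms
proof (induction A rule: finite_induct)
  case empty
  thus ?case by (simp add: square_integrable_def)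
next
  case (insert a A)
  thus ?case by (simp add: square_integrable_add)
qed

text \<open>Change of variables along a measure preserving map; it serves for \<open>pick\<close>,
  \<open>merge\<close>, restriction and evaluation at a coordinate.\<close>

lemma square_integrable_distr:
  assumes "T \<in> M \<rightarrow>\<^sub>M N" "distr M N T = N" "square_integrable N f"
  shows "square_integrable M (\<lambda>x. f (T x))"
proof -
  have [measurable]: "f \<in> borel_measurable N" using assms by (simp add: square_integrable_def)
  have "integrable (distr M N T) (\<lambda>x. (f x)\<^sup>2)" using assms by (simp add: square_integrable_def)
  hence "integrable M (\<lambda>x. (f (T x))\<^sup>2)" using assms(1) by (subst (asm) integrable_distr_eq) auto
  thus ?thesis using assms(1) by (simp add: square_integrable_def)
qed

section \<open>Independent copies of coordinates and the correlation set function\<close>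

locale replicas = prob_space \<mu> for \<mu> :: "'a measure" +
  fixes V :: "'i set"
  assumes finite_V: "finite V"
begin

abbreviation P :: "'i set \<Rightarrow> ('i \<Rightarrow> 'a) measure" where
  "P S \<equiv> (\<Pi>\<^sub>M i\<in>S. \<mu>)"

abbreviation Q :: "('i \<times> nat \<Rightarrow> 'a) measure" where
  "Q \<equiv> (\<Pi>\<^sub>M i\<in>UNIV. \<mu>)"

text \<open>A point of \<open>Q\<close> consists of infinitely many independent copies of each coordinate;
  \<open>pick s\<close> assembles a point of the product space, using copy \<open>s i\<close> of coordinate \<open>i\<close>.\<close>

definition pick :: "('i \<Rightarrow> nat) \<Rightarrow> ('i \<times> nat \<Rightarrow> 'a) \<Rightarrow> 'i \<Rightarrow> 'a" where
  "pick s \<omega> = (\<lambda>i\<in>V. \<omega> (i, s i))"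

lemma pick_measurable [measurable]: "pick s \<in> Q \<rightarrow>\<^sub>M P V"
  unfolding pick_def by measurable

lemma distr_reindex:
  fixes h :: "'j \<Rightarrow> 'i \<times> nat"
  assumes "inj_on h I"
  shows "distr Q (\<Pi>\<^sub>M i\<in>I. \<mu>) (\<lambda>\<omega>. \<lambda>k\<in>I. \<omega> (h k)) = (\<Pi>\<^sub>M i\<in>I. \<mu>)"
  using distr_PiM_reindex[of UNIV "\<lambda>_. \<mu>" h I] assms prob_space_axioms by simp

lemma distr_pick: "distr Q (P V) (pick s) = P V"
  using distr_reindex[of "\<lambda>i. (i, s i)" V] unfolding pick_def by (simp add: inj_on_def)

sublocale Q: prob_space Q
  by (intro prob_space_PiM prob_space_axioms)

sublocale P: prob_space "P S" for S
  by (intro prob_space_PiM prob_space_axioms)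

sublocale PS: product_sigma_finite "\<lambda>_::'i. \<mu>"
  by unfold_locales

lemma square_integrable_pick:
  "square_integrable (P V) f \<Longrightarrow> square_integrable Q (\<lambda>\<omega>. f (pick s \<omega>))"
  by (rule square_integrable_distr[OF pick_measurable distr_pick])

lemma AE_pick:
  assumes "AE x in P V. R x"
  shows "AE \<omega> in Q. R (pick s \<omega>)"
  by (rule AE_distrD[OF pick_measurable]) (unfold distr_pick, rule assms)

definition coupling :: "(('i \<Rightarrow> 'a) \<Rightarrow> real) \<Rightarrow> (('i \<Rightarrow> 'a) \<Rightarrow> real) \<Rightarrow> ('i \<Rightarrow> nat) \<Rightarrow> ('i \<Rightarrow> nat) \<Rightarrow> real" where
  "coupling f g s t = (LINT \<omega>|Q. f (pick s \<omega>) * g (pick t \<omega>))"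

lemma integrable_coupling:
  assumes "square_integrable (P V) f" "square_integrable (P V) g"
  shows "integrable Q (\<lambda>\<omega>. f (pick s \<omega>) * g (pick t \<omega>))"
  by (intro square_integrable_prod square_integrable_pick assms)

text \<open>Both sides reduce to one model that holds copy \<open>0\<close> of every coordinate and
  copy \<open>1\<close> only where the selections differ. So the joint law of \<open>pick s\<close>
  and \<open>pick t\<close> depends on their agreement set alone.\<close>

lemma coupling_cong:
  assumes [measurable]: "f \<in> borel_measurable (P V)" "g \<in> borel_measurable (P V)"
    and agree: "\<And>i. i \<in> V \<Longrightarrow> s i = t i \<longleftrightarrow> s' i = t' i"
  shows "coupling f g s t = coupling f g s' t'"
proof -
  define A where "A = {i\<in>V. s i = t i}"
  define I where "I = V \<times> {0} \<union> (V - A) \<times> {1::nat}"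
  define R where "R = (\<Pi>\<^sub>M k\<in>I. \<mu>)"
  define r1 where "r1 z = (\<lambda>i\<in>V. z (i, 0::nat))" for z :: "'i \<times> nat \<Rightarrow> 'a"
  define r2 where "r2 z = (\<lambda>i\<in>V. z (i, if i \<in> A then 0 else 1::nat))" for z :: "'i \<times> nat \<Rightarrow> 'a"
  have [measurable]: "r1 \<in> R \<rightarrow>\<^sub>M P V" "r2 \<in> R \<rightarrow>\<^sub>M P V"
    unfolding r1_def r2_def R_def I_def
    by (auto intro!: measurable_restrict measurable_component_singleton)
  have "coupling f g u v = (LINT z|R. f (r1 z) * g (r2 z))"
    if uv: "\<And>i. i \<in> V \<Longrightarrow> u i = v i \<longleftrightarrow> i \<in> A" for u v
  proof -
    \<comment> \<open>\<open>h\<close> sends the copies of the model to those selected by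
      \<open>u\<close> and \<open>v\<close>. It is injective because \<open>u i\<close> and
      \<open>v i\<close> differ off \<open>A\<close>, so the selected components of \<open>Q\<close>
      have the law \<open>R\<close>.\<close>
    define h where "h = (\<lambda>(i, j). (i, if j = (0::nat) then u i else v i))"
    have "inj_on h I"
      using uv by (fastforce simp: inj_on_def h_def I_def)
    hence "R = distr Q R (\<lambda>\<omega>. \<lambda>k\<in>I. \<omega> (h k))"
      unfolding R_def by (rule distr_reindex[symmetric])
    hence "(LINT z|R. f (r1 z) * g (r2 z)) = (LINT z|distr Q R (\<lambda>\<omega>. \<lambda>k\<in>I. \<omega> (h k)). f (r1 z) * g (r2 z))"
      by simp
    also have "\<dots> = (LINT \<omega>|Q. f (r1 (\<lambda>k\<in>I. \<omega> (h k))) * g (r2 (\<lambda>k\<in>I. \<omega> (h k))))"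
    proof (rule integral_distr)
      show "(\<lambda>\<omega>. \<lambda>k\<in>I. \<omega> (h k)) \<in> Q \<rightarrow>\<^sub>M R" unfolding R_def by measurable
    qed measurable
    also have "\<dots> = coupling f g u v"
    proof -
      have "r1 (\<lambda>k\<in>I. \<omega> (h k)) = pick u \<omega>" for \<omega>
        by (auto simp: r1_def pick_def I_def h_def fun_eq_iff)
      moreover have "r2 (\<lambda>k\<in>I. \<omega> (h k)) = pick v \<omega>" for \<omega>
      proof
        fix i
        show "r2 (\<lambda>k\<in>I. \<omega> (h k)) i = pick v \<omega> i"
          using uv[of i] by (cases "i \<in> A") (auto simp: r2_def pick_def I_def h_def)
      qed
      ultimately show ?thesis by (simp add: coupling_def)
    qed
    finally show ?thesis ..
  qed
  from this[of s t] this[of s' t'] show ?thesis using agree by (simp add: A_def)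
qed

text \<open>The \<open>b S\<close> of the overview in one concrete choice of copies; by
  \<open>coupling_eq_corr\<close> any choice with agreement set \<open>S\<close> gives the same
  value.\<close>

definition corr :: "(('i \<Rightarrow> 'a) \<Rightarrow> real) \<Rightarrow> (('i \<Rightarrow> 'a) \<Rightarrow> real) \<Rightarrow> 'i set \<Rightarrow> real" where
  "corr f g S = coupling f g (\<lambda>_. 0) (\<lambda>i. if i \<in> S then 0 else 1)"

lemma coupling_eq_corr:
  assumes "f \<in> borel_measurable (P V)" "g \<in> borel_measurable (P V)"
    and "\<And>i. i \<in> V \<Longrightarrow> s i = t i \<longleftrightarrow> i \<in> S"
  shows "coupling f g s t = corr f g S"
  unfolding corr_def using assms by (intro coupling_cong) auto

lemma corr_V:
  assumes [measurable]: "f \<in> borel_measurable (P V)" "g \<in> borel_measurable (P V)"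
  shows "corr f g V = (LINT x|P V. f x * g x)"
proof -
  have "corr f g V = coupling f g (\<lambda>_. 0) (\<lambda>_. 0)"
    by (rule coupling_eq_corr[symmetric]) auto
  also have "\<dots> = (LINT x|distr Q (P V) (pick (\<lambda>_. 0)). f x * g x)"
    unfolding coupling_def by (subst integral_distr) auto
  finally show ?thesis by (simp add: distr_pick)
qed

lemma corr_commute:
  assumes "f \<in> borel_measurable (P V)" "g \<in> borel_measurable (P V)"
  shows "corr f g S = corr g f S"
proof -
  have "corr g f S = coupling g f (\<lambda>i. if i \<in> S then 0 else 1) (\<lambda>_. 0)"
    by (rule coupling_eq_corr[symmetric]) (use assms in auto)
  thus ?thesis by (simp add: corr_def coupling_def mult.commute)
qed

text \<open>Bilinear expansion, with the mixed terms merged by \<open>corr_commute\<close>. The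
  values \<open>c = 1\<close> and \<open>c = -1\<close> serve for polarization.\<close>

lemma corr_lincomb:
  assumes "square_integrable (P V) f" "square_integrable (P V) g"
  shows "corr (\<lambda>x. f x + c * g x) (\<lambda>x. f x + c * g x) S
    = corr f f S + 2 * c * corr f g S + c\<^sup>2 * corr g g S"
proof -
  let ?s = "pick (\<lambda>_. 0)" and ?t = "pick (\<lambda>i. if i \<in> S then 0 else 1)"
  have "corr (\<lambda>x. f x + c * g x) (\<lambda>x. f x + c * g x) S
      = (LINT \<omega>|Q. f (?s \<omega>) * f (?t \<omega>) + c * (f (?s \<omega>) * g (?t \<omega>)) + c * (g (?s \<omega>) * f (?t \<omega>))
          + c\<^sup>2 * (g (?s \<omega>) * g (?t \<omega>)))"
    unfolding corr_def coupling_def by (intro Bochner_Integration.integral_cong)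
      (auto simp: algebra_simps power2_eq_square)
  also have "\<dots> = corr f f S + c * corr f g S + c * corr g f S + c\<^sup>2 * corr g g S"
    unfolding corr_def coupling_def using assms by (simp add: integrable_coupling)
  also have "corr g f S = corr f g S"
    using assms by (intro corr_commute) (auto simp: square_integrable_def)
  finally show ?thesis by (simp add: algebra_simps)
qed

lemma subset_moebius_corr_lincomb:
  assumes "square_integrable (P V) f" "square_integrable (P V) g"
  shows "subset_moebius (corr (\<lambda>x. f x + c * g x) (\<lambda>x. f x + c * g x)) S
    = subset_moebius (corr f f) S + 2 * c * subset_moebius (corr f g) S
      + c\<^sup>2 * subset_moebius (corr g g) S"
  unfolding subset_moebius_def corr_lincomb[OF assms] sum_distrib_left
  by (simp add: algebra_simps sum.distrib)

text \<open>Averaging the alternating sum of \<open>f\<close> over \<open>N\<close> independent copies of the coordinates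
  outside \<open>S\<close> and squaring, the off-diagonal terms dominate as \<open>N\<close> grows.\<close>

lemma subset_moebius_corr_nonneg:
  assumes f: "square_integrable (P V) f" and S: "S \<subseteq> V"
  shows "0 \<le> subset_moebius (corr f f) S"
proof -
  have [measurable]: "f \<in> borel_measurable (P V)" using f by (rule square_integrable_measurable)
  have fS: "finite S" using S finite_V finite_subset by blast
  \<comment> \<open>On \<open>S\<close> the set \<open>T\<close> selects between copies
    \<open>0\<close> and \<open>1\<close>; outside \<open>S\<close> copy \<open>j\<close> is used.
    Thus \<open>H j\<close> and \<open>H k\<close> with distinct indices share only copies of
    coordinates in \<open>S\<close>.\<close>
  define s where "s T j = (\<lambda>i. if i \<in> S then (if i \<in> T then 0 else 1) else j)" for T and j :: nat
  define H where "H j \<omega> = (\<Sum>T\<in>Pow S. (-1) ^ card T * f (pick (s T j) \<omega>))" for j \<omega>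
  \<comment> \<open>By \<open>coupling_cong\<close> the mean of \<open>H j * H k\<close> will be
    \<open>X\<close> for distinct indices and \<open>Y\<close> for equal ones.\<close>
  define X where "X = (\<Sum>T\<in>Pow S. \<Sum>U\<in>Pow S. (-1) ^ card T * (-1) ^ card U * coupling f f (s T 0) (s U 1))"
  define Y where "Y = (\<Sum>T\<in>Pow S. \<Sum>U\<in>Pow S. (-1) ^ card T * (-1) ^ card U * coupling f f (s T 0) (s U 0))"
  have H_sq: "square_integrable Q (H j)" for j
    unfolding H_def using fS by (intro square_integrable_sum square_integrable_cmult square_integrable_pick f) auto
  have EH: "(LINT \<omega>|Q. H j \<omega> * H k \<omega>)
     = (\<Sum>T\<in>Pow S. \<Sum>U\<in>Pow S. (-1) ^ card T * (-1) ^ card U * coupling f f (s T j) (s U k))" for j k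
  proof -
    have "(LINT \<omega>|Q. H j \<omega> * H k \<omega>) = (LINT \<omega>|Q. (\<Sum>T\<in>Pow S. \<Sum>U\<in>Pow S.
        (-1) ^ card T * (-1) ^ card U * (f (pick (s T j) \<omega>) * f (pick (s U k) \<omega>))))"
      unfolding H_def sum_product by (simp add: mult_ac)
    also have "\<dots> = (\<Sum>T\<in>Pow S. \<Sum>U\<in>Pow S. (-1) ^ card T * (-1) ^ card U * coupling f f (s T j) (s U k))"
      unfolding coupling_def using integrable_coupling[OF f f] by simp
    finally show ?thesis .
  qed
  have EH_diag: "(LINT \<omega>|Q. H j \<omega> * H j \<omega>) = Y" for j
    unfolding EH Y_def by (intro sum.cong refl arg_cong2[where f = "(*)"] coupling_cong) (auto simp: s_def)
  have EH_off: "(LINT \<omega>|Q. H j \<omega> * H k \<omega>) = X" if "j \<noteq> k" for j k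
    unfolding EH X_def by (intro sum.cong refl arg_cong2[where f = "(*)"] coupling_cong) (use that in \<open>auto simp: s_def\<close>)
  have ineq: "0 \<le> real N * Y + real N * real (N - 1) * X" for N
  proof -
    have "0 \<le> (LINT \<omega>|Q. (\<Sum>j<N. H j \<omega>)\<^sup>2)" by (rule integral_nonneg_AE) auto
    also have "\<dots> = (LINT \<omega>|Q. (\<Sum>j<N. \<Sum>k<N. H j \<omega> * H k \<omega>))"
      by (simp add: power2_eq_square sum_product)
    also have "\<dots> = (\<Sum>j<N. \<Sum>k<N. (LINT \<omega>|Q. H j \<omega> * H k \<omega>))"
      using square_integrable_prod[OF H_sq H_sq] by simp
    also have "\<dots> = (\<Sum>j<N. Y + real (N - 1) * X)"
    proof (intro sum.cong refl)
      fix j assume j: "j \<in> {..<N}"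
      have "(\<Sum>k<N. LINT \<omega>|Q. H j \<omega> * H k \<omega>) = (\<Sum>k\<in>insert j ({..<N} - {j}). LINT \<omega>|Q. H j \<omega> * H k \<omega>)"
        using j by (intro sum.cong) auto
      also have "\<dots> = Y + (\<Sum>k\<in>{..<N} - {j}. X)"
        by (subst sum.insert) (auto simp: EH_diag EH_off)
      finally show "(\<Sum>k<N. LINT \<omega>|Q. H j \<omega> * H k \<omega>) = Y + real (N - 1) * X" using j by simp
    qed
    finally show ?thesis by (cases N) (simp_all add: algebra_simps)
  qed
  \<comment> \<open>If \<open>X\<close> were negative, the quadratic term in \<open>N\<close> would
    eventually outweigh the linear one.\<close>
  have X_nonneg: "0 \<le> X"
  proof (rule ccontr)
    assume "\<not> 0 \<le> X"
    then obtain m :: nat where m: "Y < real m * (- X)" using reals_Archimedean3[of "- X"] by auto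
    have "0 \<le> real (Suc m) * (Y + real m * X)" using ineq[of "Suc m"] by (simp add: algebra_simps)
    hence "0 \<le> Y + real m * X" by (simp add: zero_le_mult_iff)
    with m show False by simp
  qed
  have "X = (\<Sum>T\<in>Pow S. \<Sum>W\<in>Pow S. (-1) ^ card (S - W) * corr f f W)"
    unfolding X_def
  proof (rule sum.cong[OF refl])
    fix T assume T: "T \<in> Pow S"
    \<comment> \<open>For fixed \<open>T\<close> this is an involution on the subsets of
      \<open>S\<close>. It records where \<open>s T 0\<close> and \<open>s U 1\<close> agree, which
      they never do outside \<open>S\<close>; its complement in \<open>S\<close> is the symmetric
      difference of \<open>T\<close> and \<open>U\<close>, and this accounts for the sign.\<close>
    define \<Delta> where "\<Delta> U = {i\<in>S. i \<in> T \<longleftrightarrow> i \<in> U}" for U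
    show "(\<Sum>U\<in>Pow S. (-1) ^ card T * (-1) ^ card U * coupling f f (s T 0) (s U 1))
      = (\<Sum>W\<in>Pow S. (-1) ^ card (S - W) * corr f f W)"
    proof (rule sum.reindex_bij_witness[of _ \<Delta> \<Delta>])
      fix U assume U: "U \<in> Pow S"
      have fin: "finite T" "finite U" using T U fS finite_subset by auto
      have "S - \<Delta> U = (T - U) \<union> (U - T)" using T U by (auto simp: \<Delta>_def)
      hence "card (S - \<Delta> U) = card (T - U) + card (U - T)"
        using fin by (auto intro: card_Un_disjoint)
      moreover have "card T = card (T - U) + card (T \<inter> U)" "card U = card (U - T) + card (T \<inter> U)"
        using fin by (simp_all add: card_Diff_subset_Int card_mono Int_commute)
      ultimately have "(-1::real) ^ card (S - \<Delta> U) = (-1) ^ card T * (-1) ^ card U"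
        by (simp add: power_add mult_ac flip: power2_eq_square power_mult)
      moreover have "coupling f f (s T 0) (s U 1) = corr f f (\<Delta> U)"
        by (rule coupling_eq_corr) (use U in \<open>auto simp: s_def \<Delta>_def\<close>)
      ultimately show "(-1) ^ card (S - \<Delta> U) * corr f f (\<Delta> U)
          = (-1) ^ card T * (-1) ^ card U * coupling f f (s T 0) (s U 1)" by simp
    qed (use T in \<open>auto simp: \<Delta>_def\<close>)
  qed
  \<comment> \<open>Each of the \<open>2 ^ card S\<close> sets \<open>T\<close> contributes the same
    inner sum.\<close>
  also have "\<dots> = 2 ^ card S * subset_moebius (corr f f) S"
    using fS by (simp add: subset_moebius_def card_Pow)
  finally show ?thesis using X_nonneg by (auto simp: zero_le_mult_iff power_le_zero_eq)
qed

text \<open>Nonnegativity for \<open>f + g\<close> and \<open>f - g\<close> bounds each mixed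
  coefficient by the mean of the two pure ones, and those sum over all \<open>S\<close> to the
  values at \<open>V\<close>, the second moments.\<close>

lemma sum_abs_subset_moebius_corr_le:
  assumes f: "square_integrable (P V) f" and g: "square_integrable (P V) g"
    and "(LINT x|P V. (f x)\<^sup>2) \<le> 1" "(LINT x|P V. (g x)\<^sup>2) \<le> 1"
  shows "(\<Sum>S\<in>Pow V. \<bar>subset_moebius (corr f g) S\<bar>) \<le> 1"
proof -
  have "(\<Sum>S\<in>Pow V. \<bar>subset_moebius (corr f g) S\<bar>)
      \<le> (\<Sum>S\<in>Pow V. (subset_moebius (corr f f) S + subset_moebius (corr g g) S) / 2)"
  proof (intro sum_mono)
    fix S assume "S \<in> Pow V"
    hence "0 \<le> subset_moebius (corr (\<lambda>x. f x + c * g x) (\<lambda>x. f x + c * g x)) S" for c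
      using f g by (intro subset_moebius_corr_nonneg square_integrable_add square_integrable_cmult) auto
    from this[of 1] this[of "-1"]
    show "\<bar>subset_moebius (corr f g) S\<bar> \<le> (subset_moebius (corr f f) S + subset_moebius (corr g g) S) / 2"
      unfolding subset_moebius_corr_lincomb[OF f g] by simp
  qed
  also have "\<dots> = (corr f f V + corr g g V) / 2"
    using finite_V by (simp add: sum_subset_moebius sum.distrib flip: sum_divide_distrib)
  also have "\<dots> \<le> 1"
    using assms by (simp add: corr_V square_integrable_measurable flip: power2_eq_square)
  finally show ?thesis .
qed

end

section \<open>Conditional expectations given a set of coordinates\<close>

lemma (in prob_space) square_integrable_integrable:
  fixes f :: "'a \<Rightarrow> real"
  assumes "square_integrable M f"
  shows "integrable M f"
proof (rule square_integrable_imp_integrable)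
  show "f \<in> borel_measurable M" "integrable M (\<lambda>x. (f x)\<^sup>2)"
    using assms unfolding square_integrable_def by blast+
qed

lemma (in prob_space) square_integral_le:
  fixes X :: "'a \<Rightarrow> real"
  assumes "square_integrable M X"
  shows "(LINT x|M. X x)\<^sup>2 \<le> (LINT x|M. (X x)\<^sup>2)"
proof -
  have "integrable M (\<lambda>x. (X x)\<^sup>2)" using assms unfolding square_integrable_def by blast
  from variance_eq[OF square_integrable_integrable[OF assms] this] variance_positive[of X]
  show ?thesis by linarith
qed

context replicas
begin

text \<open>The conditional expectation of \<open>f\<close> given the coordinates in
  \<open>S\<close>, as a function on \<open>P S\<close>.\<close>

definition slice :: "(('i \<Rightarrow> 'a) \<Rightarrow> real) \<Rightarrow> 'i set \<Rightarrow> ('i \<Rightarrow> 'a) \<Rightarrow> real" where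
  "slice f S u = (LINT w|P (V - S). f (merge S (V - S) (u, w)))"

lemma slice_measurable:
  assumes "S \<subseteq> V" "f \<in> borel_measurable (P V)"
  shows "slice f S \<in> borel_measurable (P S)"
proof -
  have V: "S \<union> (V - S) = V" using assms by auto
  have [measurable]: "f \<in> borel_measurable (P (S \<union> (V - S)))" using assms V by simp
  show ?thesis unfolding slice_def by measurable
qed

lemma distr_merge_pair:
  assumes "S \<subseteq> V"
  shows "distr (P S \<Otimes>\<^sub>M P (V - S)) (P V) (merge S (V - S)) = P V"
proof -
  have V: "S \<union> (V - S) = V" using assms by blast
  have "finite S" "finite (V - S)" using assms finite_V by (auto intro: finite_subset)
  from PS.distr_merge[OF _ this] show ?thesis unfolding V by blast
qed

lemma merge_measurable_pair:
  assumes "S \<subseteq> V"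
  shows "merge S (V - S) \<in> P S \<Otimes>\<^sub>M P (V - S) \<rightarrow>\<^sub>M P V"
proof -
  have V: "S \<union> (V - S) = V" using assms by blast
  show ?thesis using measurable_merge[of S "V - S" "\<lambda>_. \<mu>"] unfolding V .
qed

text \<open>In each fibre \<open>square_integral_le\<close> bounds the square of the mean by the
  mean of the square, which is integrable by Fubini. Integrability in the fibre is only known almost
  everywhere, so the comparison is an almost everywhere one.\<close>

lemma square_integrable_slice:
  assumes S: "S \<subseteq> V" and f: "square_integrable (P V) f"
  shows "square_integrable (P S) (slice f S)"
proof -
  interpret pair: pair_prob_space "P S" "P (V - S)" ..
  have [measurable]: "slice f S \<in> borel_measurable (P S)"
    using assms by (intro slice_measurable square_integrable_measurable)
  have sq: "square_integrable (P S \<Otimes>\<^sub>M P (V - S)) (\<lambda>z. f (merge S (V - S) z))"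
    by (rule square_integrable_distr[OF merge_measurable_pair[OF S] distr_merge_pair[OF S] f])
  have "integrable (P S) (\<lambda>u. LINT w|P (V - S). (f (merge S (V - S) (u, w)))\<^sup>2)"
    using sq by (intro pair.integrable_fst') (simp add: square_integrable_def)
  moreover have "AE u in P S. (slice f S u)\<^sup>2 \<le> (LINT w|P (V - S). (f (merge S (V - S) (u, w)))\<^sup>2)"
  proof -
    have "AE u in P S. integrable (P (V - S)) (\<lambda>w. (f (merge S (V - S) (u, w)))\<^sup>2)"
      using sq by (intro pair.AE_integrable_fst') (simp add: square_integrable_def)
    thus ?thesis
    proof (rule AE_mp, intro AE_I2 impI)
      fix u assume u: "u \<in> space (P S)"
        and i: "integrable (P (V - S)) (\<lambda>w. (f (merge S (V - S) (u, w)))\<^sup>2)"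
      have "(\<lambda>w. f (merge S (V - S) (u, w))) \<in> borel_measurable (P (V - S))"
        by (rule measurable_Pair2[OF square_integrable_measurable[OF sq] u])
      with i show "(slice f S u)\<^sup>2 \<le> (LINT w|P (V - S). (f (merge S (V - S) (u, w)))\<^sup>2)"
        unfolding slice_def by (intro P.square_integral_le) (simp add: square_integrable_def)
    qed
  qed
  hence "AE u in P S. norm ((slice f S u)\<^sup>2) \<le> norm (LINT w|P (V - S). (f (merge S (V - S) (u, w)))\<^sup>2)"
    by (rule AE_mp) (rule AE_I2, simp)
  ultimately have "integrable (P S) (\<lambda>u. (slice f S u)\<^sup>2)"
    by (intro Bochner_Integration.integrable_bound[of "P S" _ "\<lambda>u. (slice f S u)\<^sup>2"]
        borel_measurable_power slice_measurable square_integrable_measurable S f)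
  thus ?thesis by (simp add: square_integrable_def)
qed

lemma distr_restrict:
  assumes "S \<subseteq> V"
  shows "distr (P V) (P S) (\<lambda>x. restrict x S) = P S"
  using distr_PiM_reindex[of V "\<lambda>_. \<mu>" "\<lambda>i. i" S] assms prob_space_axioms
  by (simp add: subset_eq)

text \<open>The characteristic property of a conditional expectation: Fubini for the splitting of
  \<open>V\<close> into \<open>S\<close> and \<open>V - S\<close>, where the factor \<open>h\<close>
  is constant on each fibre.\<close>

lemma integral_slice:
  assumes S: "S \<subseteq> V" and f: "square_integrable (P V) f" and h: "square_integrable (P S) h"
  shows "(LINT x|P V. f x * h (restrict x S)) = (LINT u|P S. slice f S u * h u)"
proof -
  have V: "S \<union> (V - S) = V" using S by auto
  have meas: "(\<lambda>x. restrict x S) \<in> P V \<rightarrow>\<^sub>M P S"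
    using S by (intro measurable_restrict_subset)
  have "square_integrable (P V) (\<lambda>x. h (restrict x S))"
    by (rule square_integrable_distr[OF meas distr_restrict[OF S] h])
  hence int: "integrable (P (S \<union> (V - S))) (\<lambda>x. f x * h (restrict x S))"
    unfolding V using f by (intro square_integrable_prod)
  have "(LINT x|P V. f x * h (restrict x S))
      = (LINT u|P S. LINT w|P (V - S). f (merge S (V - S) (u, w)) * h (restrict (merge S (V - S) (u, w)) S))"
    using PS.product_integral_fold[OF _ _ _ int] S finite_V finite_subset[of S V] by (simp only: V) auto
  also have "\<dots> = (LINT u|P S. slice f S u * h u)"
    unfolding slice_def
    by (intro Bochner_Integration.integral_cong refl) (simp add: space_PiM)
  finally show ?thesis .
qed

text \<open>The components of \<open>Q\<close> are independent, and the two maps read disjoint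
  blocks of them.\<close>

lemma distr_independent_copy:
  assumes S: "S \<subseteq> V"
  shows "distr Q (P V \<Otimes>\<^sub>M P (V - S)) (\<lambda>\<omega>. (pick (\<lambda>_. 0) \<omega>, \<lambda>i\<in>V - S. \<omega> (i, 1)))
    = P V \<Otimes>\<^sub>M P (V - S)"
proof -
  let ?A = "V \<times> {0::nat}" and ?B = "(V - S) \<times> {1::nat}"
  let ?Y1 = "\<lambda>z :: 'i \<times> nat \<Rightarrow> 'a. \<lambda>i\<in>V. z (i, 0)"
  let ?Y2 = "\<lambda>z :: 'i \<times> nat \<Rightarrow> 'a. \<lambda>i\<in>V - S. z (i, 1)"
  have comp: "distr Q \<mu> (\<lambda>\<omega>. \<omega> k) = \<mu>" for k
    by (rule distr_PiM_component) (auto intro: prob_space_axioms)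
  have "Q.indep_vars (\<lambda>_. \<mu>) (\<lambda>k \<omega>. \<omega> k) UNIV"
    by (subst Q.indep_vars_iff_distr_eq_PiM) (auto simp: comp restrict_UNIV distr_id2)
  hence "Q.indep_var (\<Pi>\<^sub>M k\<in>?A. \<mu>) (\<lambda>\<omega>. \<lambda>k\<in>?A. \<omega> k) (\<Pi>\<^sub>M k\<in>?B. \<mu>) (\<lambda>\<omega>. \<lambda>k\<in>?B. \<omega> k)"
    by (rule Q.indep_var_restrict) auto
  hence "Q.indep_var (P V) (?Y1 \<circ> (\<lambda>\<omega>. \<lambda>k\<in>?A. \<omega> k)) (P (V - S)) (?Y2 \<circ> (\<lambda>\<omega>. \<lambda>k\<in>?B. \<omega> k))"
    by (rule Q.indep_var_compose) (auto intro!: measurable_restrict measurable_component_singleton)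
  moreover have "?Y1 \<circ> (\<lambda>\<omega>. \<lambda>k\<in>?A. \<omega> k) = pick (\<lambda>_. 0)"
    "?Y2 \<circ> (\<lambda>\<omega>. \<lambda>k\<in>?B. \<omega> k) = (\<lambda>\<omega>. \<lambda>i\<in>V - S. \<omega> (i, 1))"
    by (auto simp: pick_def fun_eq_iff)
  ultimately have "Q.indep_var (P V) (pick (\<lambda>_. 0)) (P (V - S)) (\<lambda>\<omega>. \<lambda>i\<in>V - S. \<omega> (i, 1))"
    by simp
  moreover have "distr Q (P (V - S)) (\<lambda>\<omega>. \<lambda>i\<in>V - S. \<omega> (i, 1)) = P (V - S)"
    by (rule distr_reindex) (auto simp: inj_on_def)
  ultimately show ?thesis
    unfolding Q.indep_var_distribution_eq by (simp add: distr_pick)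
qed

text \<open>The second selection is \<open>merge\<close> of the first one restricted to
  \<open>S\<close> with a fresh copy on \<open>V - S\<close>. Integrating out the fresh copy turns
  \<open>g\<close> into its slice; then \<open>integral_slice\<close> does the same for
  \<open>f\<close>.\<close>

lemma corr_eq_slice:
  assumes S: "S \<subseteq> V" and f: "square_integrable (P V) f" and g: "square_integrable (P V) g"
  shows "corr f g S = (LINT u|P S. slice f S u * slice g S u)"
proof -
  interpret pair: pair_prob_space "P V" "P (V - S)" ..
  let ?R = "P V \<Otimes>\<^sub>M P (V - S)"
  let ?T = "\<lambda>\<omega>. (pick (\<lambda>_. 0) \<omega>, \<lambda>i\<in>V - S. \<omega> (i, 1))"
  let ?F = "\<lambda>z. f (fst z) * g (merge S (V - S) (restrict (fst z) S, snd z))"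
  have [measurable]: "f \<in> borel_measurable (P V)" "g \<in> borel_measurable (P V)"
    using f g by (auto simp: square_integrable_def)
  have [measurable]: "(\<lambda>x. restrict x S) \<in> P V \<rightarrow>\<^sub>M P S"
    using S by (intro measurable_restrict_subset)
  note [measurable] = merge_measurable_pair[OF S]
  have F_meas: "?F \<in> borel_measurable ?R" by measurable
  have T_meas [measurable]: "?T \<in> Q \<rightarrow>\<^sub>M ?R" by measurable
  have F_T: "?F (?T \<omega>) = f (pick (\<lambda>_. 0) \<omega>) * g (pick (\<lambda>i. if i \<in> S then 0 else 1) \<omega>)" for \<omega>
  proof -
    have "merge S (V - S) (restrict (pick (\<lambda>_. 0) \<omega>) S, \<lambda>i\<in>V - S. \<omega> (i, 1))
        = pick (\<lambda>i. if i \<in> S then 0 else 1) \<omega>"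
      using S by (auto simp: merge_def pick_def fun_eq_iff)
    thus ?thesis by simp
  qed
  have int: "integrable ?R ?F"
  proof -
    have "integrable Q (\<lambda>\<omega>. ?F (?T \<omega>))" unfolding F_T by (rule integrable_coupling[OF f g])
    hence "integrable (distr Q ?R ?T) ?F" by (rule iffD2[OF integrable_distr_eq[OF T_meas F_meas]])
    thus ?thesis by (simp only: distr_independent_copy[OF S])
  qed
  have "corr f g S = (LINT \<omega>|Q. ?F (?T \<omega>))" unfolding corr_def coupling_def F_T ..
  also have "\<dots> = (LINT z|distr Q ?R ?T. ?F z)" by (rule integral_distr[OF T_meas F_meas, symmetric])
  also have "\<dots> = (LINT z|?R. ?F z)" by (simp only: distr_independent_copy[OF S])
  also have "\<dots> = (LINT x|P V. LINT w|P (V - S). ?F (x, w))"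
    using int by (rule pair.integral_fst'[symmetric])
  also have "\<dots> = (LINT x|P V. f x * slice g S (restrict x S))" by (simp add: slice_def)
  also have "\<dots> = (LINT u|P S. slice f S u * slice g S u)"
    by (rule integral_slice[OF S f square_integrable_slice[OF S g]])
  finally show ?thesis .
qed

text \<open>With no coordinate kept, both slices are constants, namely the means.\<close>

lemma corr_empty:
  assumes f: "square_integrable (P V) f" and g: "square_integrable (P V) g"
  shows "corr f g {} = (LINT x|P V. f x) * (LINT x|P V. g x)"
proof -
  have "slice h {} u = (LINT x|P V. h x)" if "square_integrable (P V) h" for h u
  proof -
    have "merge {} V (u, w) = w" if "w \<in> space (P V)" for w
      using that by (auto simp: merge_def fun_eq_iff space_PiM PiE_def extensional_def)
    thus ?thesis unfolding slice_def
      by (intro Bochner_Integration.integral_cong) auto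
  qed
  thus ?thesis using corr_eq_slice[of "{}" f g] f g P.prob_space[of "{}"] by simp
qed

text \<open>Functions on \<open>{i}\<close> are identified with their single value, so that
  Parseval's identity in one variable becomes applicable.\<close>

definition coordinate_slice :: "(('i \<Rightarrow> 'a) \<Rightarrow> real) \<Rightarrow> 'i \<Rightarrow> 'a \<Rightarrow> real" where
  "coordinate_slice f i t = slice f {i} (\<lambda>_\<in>{i}. t)"

lemma coordinate_slice_eq:
  "u \<in> space (P {i}) \<Longrightarrow> coordinate_slice f i (u i) = slice f {i} u"
  unfolding coordinate_slice_def
  by (rule arg_cong[where f = "slice f {i}"]) (auto simp: space_PiM PiE_def extensional_def fun_eq_iff)

lemma square_integrable_coordinate_slice:
  assumes "i \<in> V" "square_integrable (P V) f"
  shows "square_integrable \<mu> (coordinate_slice f i)"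
proof -
  have sq: "square_integrable (P {i}) (slice f {i})"
    using assms by (intro square_integrable_slice) auto
  have "(\<lambda>t. \<lambda>_\<in>{i}. t) \<in> \<mu> \<rightarrow>\<^sub>M P {i}" by measurable
  hence meas: "coordinate_slice f i \<in> borel_measurable \<mu>"
    unfolding coordinate_slice_def using square_integrable_measurable[OF sq]
    by (rule measurable_compose)
  have "integrable (P {i}) (\<lambda>u. (coordinate_slice f i (u i))\<^sup>2)"
    using sq by (simp add: square_integrable_def coordinate_slice_eq cong: Bochner_Integration.integrable_cong)
  moreover have "distr (P {i}) \<mu> (\<lambda>u. u i) = \<mu>"
    using PS.distr_singleton[of i] by simp
  ultimately have "integrable \<mu> (\<lambda>t. (coordinate_slice f i t)\<^sup>2)"
    using integrable_distr_eq[of "\<lambda>u. u i" "P {i}" \<mu> "\<lambda>t. (coordinate_slice f i t)\<^sup>2"] meas by simp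
  with meas show ?thesis by (simp add: square_integrable_def)
qed

lemma integral_coordinate_slice:
  assumes "i \<in> V" "square_integrable (P V) f" "square_integrable \<mu> h"
  shows "(LINT x|P V. f x * h (x i)) = (LINT t|\<mu>. coordinate_slice f i t * h t)"
proof -
  have "square_integrable (P {i}) (\<lambda>u. h (u i))"
    by (rule square_integrable_distr[OF _ _ assms(3)]) (use PS.distr_singleton[of i] in auto)
  hence "(LINT x|P V. f x * h (restrict x {i} i)) = (LINT u|P {i}. slice f {i} u * h (u i))"
    using assms by (intro integral_slice) auto
  also have "\<dots> = (LINT u|P {i}. coordinate_slice f i (u i) * h (u i))"
    by (intro Bochner_Integration.integral_cong) (auto simp: coordinate_slice_eq)
  also have "\<dots> = (LINT t|\<mu>. coordinate_slice f i t * h t)"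
    using assms square_integrable_coordinate_slice[of i f]
    by (intro PS.product_integral_singleton) (auto simp: square_integrable_def)
  finally show ?thesis by simp
qed

lemma corr_singleton:
  assumes "i \<in> V" "square_integrable (P V) f" "square_integrable (P V) g"
  shows "corr f g {i} = (LINT t|\<mu>. coordinate_slice f i t * coordinate_slice g i t)"
proof -
  have "corr f g {i} = (LINT u|P {i}. coordinate_slice f i (u i) * coordinate_slice g i (u i))"
    using assms by (subst corr_eq_slice)
      (auto intro!: Bochner_Integration.integral_cong simp: coordinate_slice_eq)
  also have "\<dots> = (LINT t|\<mu>. coordinate_slice f i t * coordinate_slice g i t)"
    by (intro PS.product_integral_singleton borel_measurable_times square_integrable_measurable
        square_integrable_coordinate_slice assms)
  finally show ?thesis .
qed

end

section \<open>Correlations of monotone functions\<close>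

locale ordered_replicas = replicas \<mu> V
  for \<mu> :: "'a::linorder measure" and V :: "'i set"
begin

text \<open>The difference of two values of \<open>corr\<close> is an average of products of increments of
  \<open>f\<close> and \<open>g\<close> in the same coordinate \<open>i\<close>, both from copy 1 to copy 0.\<close>

lemma corr_insert_mono:
  assumes f: "square_integrable (P V) f" and g: "square_integrable (P V) g"
    and f0: "monotone_on (space (P V)) (\<lambda>x y. \<forall>i\<in>V. x i \<le> y i) (\<le>) f0" "AE x in P V. f0 x = f x"
    and g0: "monotone_on (space (P V)) (\<lambda>x y. \<forall>i\<in>V. x i \<le> y i) (\<le>) g0" "AE x in P V. g0 x = g x"
    and i: "i \<in> V" "i \<notin> S"
  shows "corr f g S \<le> corr f g (insert i S)"
proof -
  \<comment> \<open>The parameter is the copy used at \<open>i\<close>; away from \<open>i\<close>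
    the selections \<open>s a\<close> and \<open>t b\<close> agree exactly on
    \<open>S\<close>.\<close>
  define s where "s b = (\<lambda>_. 0)(i := b)" for b :: nat
  define t where "t b = (\<lambda>j. if j \<in> S then 0 else 1)(i := b)" for b :: nat
  have [measurable]: "f \<in> borel_measurable (P V)" "g \<in> borel_measurable (P V)"
    using f g by (auto simp: square_integrable_def)
  have pick_space: "pick u \<omega> \<in> space (P V)" if "\<omega> \<in> space Q" for u \<omega>
    using that pick_measurable by (rule measurable_space[rotated])
  have "AE \<omega> in Q. f0 (pick u \<omega>) = f (pick u \<omega>)" "AE \<omega> in Q. g0 (pick u \<omega>) = g (pick u \<omega>)" for u
    by (rule AE_pick[OF f0(2)], rule AE_pick[OF g0(2)])
  \<comment> \<open>Monotonicity is known for \<open>f0\<close> and \<open>g0\<close> only, which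
    agree with \<open>f\<close> and \<open>g\<close> off null sets; finitely many evaluations keep
    the exceptional set null.\<close>
  hence "AE \<omega> in Q. f0 (pick (s 0) \<omega>) = f (pick (s 0) \<omega>) \<and> f0 (pick (s 1) \<omega>) = f (pick (s 1) \<omega>)
      \<and> g0 (pick (t 0) \<omega>) = g (pick (t 0) \<omega>) \<and> g0 (pick (t 1) \<omega>) = g (pick (t 1) \<omega>)"
    by (intro AE_conjI)
  hence "AE \<omega> in Q. 0 \<le> (f (pick (s 0) \<omega>) - f (pick (s 1) \<omega>)) * (g (pick (t 0) \<omega>) - g (pick (t 1) \<omega>))"
  proof (rule AE_mp, intro AE_I2 impI)
    fix \<omega> assume \<omega>: "\<omega> \<in> space Q" 
      and eq: "f0 (pick (s 0) \<omega>) = f (pick (s 0) \<omega>) \<and> f0 (pick (s 1) \<omega>) = f (pick (s 1) \<omega>)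
      \<and> g0 (pick (t 0) \<omega>) = g (pick (t 0) \<omega>) \<and> g0 (pick (t 1) \<omega>) = g (pick (t 1) \<omega>)"
    have mono: "f0 (pick (s a) \<omega>) \<le> f0 (pick (s b) \<omega>)" "g0 (pick (t a) \<omega>) \<le> g0 (pick (t b) \<omega>)"
      if "\<omega> (i, a) \<le> \<omega> (i, b)" for a b
      using that pick_space[OF \<omega>]
      by (auto intro!: monotone_onD[OF f0(1)] monotone_onD[OF g0(1)] simp: pick_def s_def t_def)
    show "0 \<le> (f (pick (s 0) \<omega>) - f (pick (s 1) \<omega>)) * (g (pick (t 0) \<omega>) - g (pick (t 1) \<omega>))"
      using linear[of "\<omega> (i, 0)" "\<omega> (i, 1)"] mono[of 0 1] mono[of 1 0] eq
      by (auto simp: zero_le_mult_iff)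
  qed
  hence "0 \<le> (LINT \<omega>|Q. (f (pick (s 0) \<omega>) - f (pick (s 1) \<omega>)) * (g (pick (t 0) \<omega>) - g (pick (t 1) \<omega>)))"
    by (rule integral_nonneg_AE)
  also have "\<dots> = (LINT \<omega>|Q. f (pick (s 0) \<omega>) * g (pick (t 0) \<omega>) - f (pick (s 0) \<omega>) * g (pick (t 1) \<omega>)
      - f (pick (s 1) \<omega>) * g (pick (t 0) \<omega>) + f (pick (s 1) \<omega>) * g (pick (t 1) \<omega>))"
    by (simp add: algebra_simps)
  also have "\<dots> = coupling f g (s 0) (t 0) - coupling f g (s 0) (t 1)
      - coupling f g (s 1) (t 0) + coupling f g (s 1) (t 1)"
    unfolding coupling_def using integrable_coupling[OF f g] by simp
  also have "\<dots> = 2 * (corr f g (insert i S) - corr f g S)"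
  proof -
    \<comment> \<open>Equal copies at \<open>i\<close> enlarge the agreement set to
      \<open>insert i S\<close>; different copies leave it at \<open>S\<close>. Each happens twice,
      hence the factor \<open>2\<close>.\<close>
    have "coupling f g (s 0) (t 0) = corr f g (insert i S)" "coupling f g (s 1) (t 1) = corr f g (insert i S)"
      "coupling f g (s 0) (t 1) = corr f g S" "coupling f g (s 1) (t 0) = corr f g S"
      by (intro coupling_eq_corr; use i in \<open>auto simp: s_def t_def\<close>)+
    thus ?thesis by simp
  qed
  finally show ?thesis by simp
qed

lemma corr_mono:
  assumes "square_integrable (P V) f" "square_integrable (P V) g"
    and "monotone_on (space (P V)) (\<lambda>x y. \<forall>i\<in>V. x i \<le> y i) (\<le>) f0" "AE x in P V. f0 x = f x"
    and "monotone_on (space (P V)) (\<lambda>x y. \<forall>i\<in>V. x i \<le> y i) (\<le>) g0" "AE x in P V. g0 x = g x"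
    and "S \<subseteq> T" "T \<subseteq> V"
  shows "corr f g S \<le> corr f g T"
proof -
  have "corr f g S \<le> corr f g (S \<union> D)" if "finite D" "D \<subseteq> V" for D
    using that
  proof (induction D rule: finite_induct)
    case (insert i D)
    hence "corr f g S \<le> corr f g (S \<union> D)" by simp
    also have "\<dots> \<le> corr f g (insert i (S \<union> D))"
      using corr_insert_mono[OF assms(1-6), of i "S \<union> D"] insert.prems
      by (cases "i \<in> S \<union> D") (auto simp: insert_absorb)
    finally show ?case by simp
  qed simp
  from this[of T] show ?thesis using assms finite_subset[OF _ finite_V] by (simp add: Un_absorb1)
qed

end

subsection \<open>Parseval's identity\<close>

lemma orthonormal_basis_square_integrable:
  "orthonormal_basis M \<phi> \<Longrightarrow> square_integrable M (\<phi> i)"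
  by (simp add: orthonormal_basis_def)

text \<open>Orthonormality and completing the square in each \<open>c i\<close>. Taking Fourier
  coefficients for \<open>c\<close> gives Bessel's inequality; arbitrary \<open>c\<close> shows that
  no other combination of the same functions comes closer to \<open>h\<close>.\<close>

lemma L2_norm_sq_residual:
  assumes \<phi>: "orthonormal_basis M \<phi>" and h: "square_integrable M h"
  shows "(L2_norm M (\<lambda>x. h x - (\<Sum>i<N. c i * \<phi> i x)))\<^sup>2
    = L2_inner M h h - (\<Sum>i<N. (L2_inner M h (\<phi> i))\<^sup>2) + (\<Sum>i<N. (c i - L2_inner M h (\<phi> i))\<^sup>2)"
proof -
  have sq: "square_integrable M (\<phi> i)" for i by (rule orthonormal_basis_square_integrable[OF \<phi>])
  have orth: "(LINT x|M. \<phi> i x * \<phi> j x) = (if i = j then 1 else 0)" for i j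
    using \<phi> by (simp add: orthonormal_basis_def L2_inner_def)
  let ?s = "\<lambda>x. \<Sum>i<N. c i * \<phi> i x"
  have s: "square_integrable M ?s"
    by (intro square_integrable_sum square_integrable_cmult sq) auto
  have hs: "(LINT x|M. h x * ?s x) = (\<Sum>i<N. c i * L2_inner M h (\<phi> i))"
  proof -
    have "(LINT x|M. h x * ?s x) = (LINT x|M. (\<Sum>i<N. c i * (h x * \<phi> i x)))"
      by (simp add: sum_distrib_left mult_ac)
    also have "\<dots> = (\<Sum>i<N. LINT x|M. c i * (h x * \<phi> i x))"
      by (rule Bochner_Integration.integral_sum) (intro integrable_mult_right square_integrable_prod h sq)
    finally show ?thesis by (simp add: L2_inner_def)
  qed
  have ss: "(LINT x|M. ?s x * ?s x) = (\<Sum>i<N. (c i)\<^sup>2)"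
  proof -
    have "(LINT x|M. ?s x * ?s x) = (LINT x|M. (\<Sum>i<N. \<Sum>j<N. c i * c j * (\<phi> i x * \<phi> j x)))"
      by (simp add: sum_product mult_ac)
    also have "\<dots> = (\<Sum>i<N. \<Sum>j<N. LINT x|M. c i * c j * (\<phi> i x * \<phi> j x))"
      by (subst Bochner_Integration.integral_sum; (subst Bochner_Integration.integral_sum)?)
        (intro Bochner_Integration.integrable_sum integrable_mult_right square_integrable_prod sq refl)+
    also have "\<dots> = (\<Sum>i<N. \<Sum>j<N. if i = j then c i * c j else 0)"
      by (intro sum.cong) (auto simp: orth)
    finally show ?thesis by (simp add: power2_eq_square)
  qed
  have int: "integrable M (\<lambda>x. h x * h x)" "integrable M (\<lambda>x. h x * ?s x)" "integrable M (\<lambda>x. ?s x * ?s x)"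
    by (intro square_integrable_prod h s)+
  have "(L2_norm M (\<lambda>x. h x - ?s x))\<^sup>2 = (LINT x|M. (h x - ?s x) * (h x - ?s x))"
    unfolding L2_norm_def L2_inner_def by (intro real_sqrt_pow2 integral_nonneg_AE) auto
  also have "\<dots> = (LINT x|M. h x * h x - 2 * (h x * ?s x) + ?s x * ?s x)"
    by (rule Bochner_Integration.integral_cong[OF refl]) algebra
  also have "\<dots> = L2_inner M h h - 2 * (\<Sum>i<N. c i * L2_inner M h (\<phi> i)) + (\<Sum>i<N. (c i)\<^sup>2)"
    using int by (simp only: hs ss L2_inner_def Bochner_Integration.integral_add Bochner_Integration.integral_diff
        integrable_mult_right integral_mult_right_zero Bochner_Integration.integrable_diff)
  finally show ?thesis
    by (simp add: power2_diff sum.distrib sum_subtractf sum_distrib_left algebra_simps)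
qed

text \<open>Bessel's inequality bounds the partial sums from above, density of the span from below.
  The terms are nonnegative, so convergence is unconditional.\<close>

lemma parseval_square:
  assumes \<phi>: "orthonormal_basis M \<phi>" and h: "square_integrable M h"
  shows "((\<lambda>i. (L2_inner M h (\<phi> i))\<^sup>2) has_sum L2_inner M h h) UNIV"
proof -
  define a where "a i = (L2_inner M h (\<phi> i))\<^sup>2" for i
  have le: "(\<Sum>i<N. a i) \<le> L2_inner M h h" for N
    using L2_norm_sq_residual[OF \<phi> h, where N = N and c = "\<lambda>i. L2_inner M h (\<phi> i)"] 
      zero_le_power2[of "L2_norm M (\<lambda>x. h x - (\<Sum>i<N. L2_inner M h (\<phi> i) * \<phi> i x))"]
    by (simp add: a_def)
  have "a sums L2_inner M h h"
    unfolding sums_def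
  proof (rule LIMSEQ_I)
    fix r :: real assume "0 < r"
    hence "0 < sqrt r" by simp
    with \<phi> h obtain N c where N: "L2_norm M (\<lambda>x. h x - (\<Sum>i<N. c i * \<phi> i x)) < sqrt r"
      unfolding orthonormal_basis_def by meson
    have nonneg: "0 \<le> L2_norm M (\<lambda>x. h x - (\<Sum>i<N. c i * \<phi> i x))"
      unfolding L2_norm_def L2_inner_def by (intro real_sqrt_ge_zero integral_nonneg_AE) auto
    have "(L2_norm M (\<lambda>x. h x - (\<Sum>i<N. c i * \<phi> i x)))\<^sup>2 < (sqrt r)\<^sup>2"
      using N nonneg by (intro power_strict_mono) auto
    hence "L2_inner M h h - (\<Sum>i<N. a i) < r"
      using L2_norm_sq_residual[OF \<phi> h, where N = N and c = c] \<open>0 < r\<close>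
        sum_nonneg[of "{..<N}" "\<lambda>i. (c i - L2_inner M h (\<phi> i))\<^sup>2"] by (simp add: a_def)
    moreover have "(\<Sum>i<N. a i) \<le> (\<Sum>i<m. a i)" if "m \<ge> N" for m
      using that by (intro sum_mono2) (auto simp: a_def)
    ultimately have "norm ((\<Sum>i<m. a i) - L2_inner M h h) < r" if "m \<ge> N" for m
      using le[of m] that by fastforce
    thus "\<exists>no. \<forall>m\<ge>no. norm ((\<Sum>i<m. a i) - L2_inner M h h) < r" by blast
  qed
  moreover have "summable (\<lambda>i. norm (a i))"
    using sums_summable[OF calculation] by (simp add: a_def[abs_def])
  ultimately show ?thesis unfolding a_def[symmetric] using norm_summable_imp_has_sum by blast
qed

lemma L2_inner_add_left:
  assumes "square_integrable M h" "square_integrable M k" "square_integrable M p"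
  shows "L2_inner M (\<lambda>x. h x + c * k x) p = L2_inner M h p + c * L2_inner M k p"
proof -
  have "L2_inner M (\<lambda>x. h x + c * k x) p = (LINT x|M. h x * p x + c * (k x * p x))"
    by (simp add: L2_inner_def algebra_simps)
  thus ?thesis using assms by (simp add: square_integrable_prod L2_inner_def)
qed

lemma L2_inner_commute: "L2_inner M h k = L2_inner M k h"
  by (simp add: L2_inner_def mult.commute)

text \<open>Polarization: a quarter of the difference of \<open>parseval_square\<close> for
  \<open>h + k\<close> and for \<open>h - k\<close>.\<close>

lemma parseval:
  assumes \<phi>: "orthonormal_basis M \<phi>" and h: "square_integrable M h" and k: "square_integrable M k"
  shows "((\<lambda>i. L2_inner M h (\<phi> i) * L2_inner M k (\<phi> i)) has_sum L2_inner M h k) UNIV"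
proof -
  let ?p = "\<lambda>c x. h x + c * k x"
  have p: "square_integrable M (?p c)" for c
    by (intro square_integrable_add square_integrable_cmult h k)
  have in_p: "L2_inner M (?p c) q = L2_inner M h q + c * L2_inner M k q" if "square_integrable M q" for c q
    by (rule L2_inner_add_left[OF h k that])
  have pp: "L2_inner M (?p c) (?p c) = L2_inner M h h + 2 * c * L2_inner M h k + c\<^sup>2 * L2_inner M k k" for c
  proof -
    have "L2_inner M h (?p c) = L2_inner M h h + c * L2_inner M h k"
      "L2_inner M k (?p c) = L2_inner M h k + c * L2_inner M k k"
      using in_p[OF h, of c] in_p[OF k, of c] L2_inner_commute[of M h "?p c"] L2_inner_commute[of M k "?p c"]
        L2_inner_commute[of M k h] by simp_all
    thus ?thesis using in_p[OF p[of c], of c] by (simp add: power2_eq_square algebra_simps)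
  qed
  have "((\<lambda>i. (1/4) * ((L2_inner M (?p 1) (\<phi> i))\<^sup>2 + - ((L2_inner M (?p (-1)) (\<phi> i))\<^sup>2))) has_sum
      (1/4) * (L2_inner M (?p 1) (?p 1) + - L2_inner M (?p (-1)) (?p (-1)))) UNIV"
    by (intro has_sum_cmult_right has_sum_add has_sum_uminusI parseval_square[OF \<phi> p])
  also have "(\<lambda>i. (1/4) * ((L2_inner M (?p 1) (\<phi> i))\<^sup>2 + - ((L2_inner M (?p (-1)) (\<phi> i))\<^sup>2)))
      = (\<lambda>i. L2_inner M h (\<phi> i) * L2_inner M k (\<phi> i))"
    unfolding in_p[OF orthonormal_basis_square_integrable[OF \<phi>]]
    by (simp add: power2_eq_square algebra_simps)
  also have "(1/4) * (L2_inner M (?p 1) (?p 1) + - L2_inner M (?p (-1)) (?p (-1))) = L2_inner M h k"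
    unfolding pp by simp
  finally show ?thesis .
qed

subsection \<open>The correlation inequality\<close>

text \<open>For \<open>d = 4 * m\<close> the error term in \<open>bound\<close> is at most
  \<open>a / 2\<close>, which leaves \<open>a\<close> at most \<open>512 * D\<close> times the
  square of \<open>m\<close>. Since \<open>m <= 10 + L\<close>, and \<open>10 + L\<close> is at most
  \<open>11\<close> or \<open>11 * L\<close>, the constant is 512 * 121 = 61952; the two cases match
  the two branches of the minimum in \<open>Phi\<close>.\<close>

lemma Phi_le_of_level_one_bound:
  fixes a D :: real
  assumes a: "0 \<le> a" "a \<le> 1" and D: "0 \<le> D"
    and bound: "\<And>d::nat. d \<ge> 1 \<Longrightarrow> a \<le> 16 * (real d)\<^sup>2 * (D + (1/2) ^ d)"
  shows "1 / 61952 * Phi a \<le> D"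
proof (cases "a = 0")
  case True
  thus ?thesis using D by (simp add: Phi_def)
next
  case False
  hence a0: "0 < a" using a by simp
  define L where "L = ln (1 / a)"
  have L: "0 \<le> L" using a a0 by (simp add: L_def)
  \<comment> \<open>As \<open>exp L = 1 / a\<close>, the summand \<open>9\<close> ensures that
    \<open>a * exp m\<close> is at least \<open>exp 9\<close>, hence at least 512. Passing to
    \<open>4 ^ m\<close>, one such factor absorbs \<open>512 / a\<close> and a second one the square
    of \<open>m\<close>; together they make \<open>2 ^ (4 * m)\<close>.\<close>
  define m where "m = nat \<lceil>9 + L\<rceil>"
  have m: "9 + L \<le> real m" "real m \<le> 10 + L" using L by (auto simp: m_def) linarith+
  have "512 \<le> a * 4 ^ m"
  proof -
    have "(2::real) ^ 9 \<le> exp 1 ^ 9" using exp_ge_add_one_self[of 1] by (intro power_mono) auto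
    hence "(512::real) \<le> exp 9" by (simp flip: exp_of_nat_mult)
    hence "512 \<le> a * (exp 9 * exp L)" using a0 by (simp add: L_def)
    also have "\<dots> \<le> a * exp (real m)" using m(1) a0 by (simp flip: exp_add)
    also have "exp (real m) = exp 1 ^ m" by (simp flip: exp_of_nat_mult)
    also have "a * \<dots> \<le> a * 4 ^ m" using exp_le a0 by (intro mult_left_mono power_mono) auto
    finally show ?thesis .
  qed
  moreover have "(real m)\<^sup>2 \<le> 4 ^ m"
  proof -
    have "real m \<le> 2 ^ m" by (rule less_imp_le[OF of_nat_less_two_power])
    hence "(real m)\<^sup>2 \<le> (2 ^ m)\<^sup>2" by (intro power_mono) auto
    also have "(2 ^ m :: real)\<^sup>2 = 4 ^ m" by (simp flip: power_mult power_mult_distrib add: power2_eq_square)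
    finally show ?thesis .
  qed
  ultimately have "512 * (real m)\<^sup>2 \<le> a * 4 ^ m * 4 ^ m" 
    by (intro mult_mono) auto
  hence "512 * (real m)\<^sup>2 * (1/2) ^ (4 * m) \<le> a * (4 ^ m * 4 ^ m) * (1/2) ^ (4 * m)"
    by (intro mult_right_mono) (auto simp: mult.assoc)
  also have "(4::real) ^ m * 4 ^ m = 2 ^ (4 * m)"
    by (simp only: power_mult power_mult_distrib[symmetric]) simp
  hence "(4 ^ m * 4 ^ m) * (1/2::real) ^ (4 * m) = 1"
    by (simp add: power_one_over)
  hence "a * (4 ^ m * 4 ^ m) * (1/2) ^ (4 * m) = a" by (simp add: mult.assoc)
  finally have small: "512 * (real m)\<^sup>2 * (1/2) ^ (4 * m) \<le> a" .
  have "4 * m \<ge> 1" using m L by simp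
  from bound[OF this] small have "a \<le> 512 * (real m)\<^sup>2 * D"
    by (simp add: power_mult_distrib distrib_left)
  also have "\<dots> \<le> 512 * (10 + L)\<^sup>2 * D"
    using m D by (intro mult_right_mono mult_left_mono power_mono) auto
  finally have main: "a \<le> 512 * (10 + L)\<^sup>2 * D" .
  show ?thesis
  proof (cases "L \<le> 1")
    case True
    have "(10 + L)\<^sup>2 \<le> 11\<^sup>2" using True L by (intro power_mono) auto
    hence "512 * (10 + L)\<^sup>2 * D \<le> 512 * 11\<^sup>2 * D" using D by (intro mult_right_mono mult_left_mono) auto
    with main have "a \<le> 512 * 11\<^sup>2 * D" by (rule order_trans)
    hence "a \<le> 61952 * D" by simp
    \<comment> \<open>This includes the special value \<open>Phi 1 = 1\<close>; in the other case
      \<open>L > 1\<close> rules out \<open>a = 1\<close>.\<close>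
    moreover have "Phi a \<le> a" using a0 by (simp add: Phi_def)
    ultimately show ?thesis by simp
  next
    case False
    have "(10 + L)\<^sup>2 \<le> (11 * L)\<^sup>2" using False by (intro power_mono) auto
    hence "512 * (10 + L)\<^sup>2 * D \<le> 512 * (11 * L)\<^sup>2 * D" using D by (intro mult_right_mono mult_left_mono) auto
    with main have "a \<le> 512 * (11 * L)\<^sup>2 * D" by (rule order_trans)
    hence "a \<le> 61952 * D * L\<^sup>2" by (simp add: power_mult_distrib mult_ac)
    hence "a / L\<^sup>2 \<le> 61952 * D" using False by (simp add: divide_le_eq)
    moreover have "a \<noteq> 1" using False by (auto simp: L_def)
    hence "Phi a \<le> a / L\<^sup>2" using a0 by (simp add: Phi_def L_def)
    ultimately show ?thesis by simp
  qed
qed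

section \<open>Representatives for the uncompleted measure, and level-one coefficients\<close>

lemma integral_completion_AE:
  fixes h h' :: "'a \<Rightarrow> real"
  assumes "h \<in> borel_measurable (completion M)" "h' \<in> borel_measurable M" "AE x in M. h x = h' x"
  shows "(LINT x|completion M. h x) = (LINT x|M. h' x)"
proof -
  have "(LINT x|completion M. h x) = (LINT x|completion M. h' x)"
    using assms by (intro integral_cong_AE) (auto intro: measurable_completion AE_completion)
  thus ?thesis using assms(2) by (simp add: integral_completion)
qed

text \<open>Provides the representative to which the results on \<open>replicas\<close>, stated for
  the uncompleted product, apply.\<close>

lemma square_integrable_completion:
  assumes "square_integrable (completion M) f"
  obtains f' where "square_integrable M f'" "AE x in M. f x = f' x"
proof -
  have f: "f \<in> borel_measurable (completion M)" "integrable (completion M) (\<lambda>x. (f x)\<^sup>2)"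
    using assms by (auto simp: square_integrable_def)
  from completion_ex_borel_measurable_real[OF f(1)]
  obtain f' where f': "f' \<in> borel_measurable M" "AE x in M. f x = f' x" by blast
  have f'_c: "f' \<in> borel_measurable (completion M)" using f'(1) by (rule measurable_completion)
  have "AE x in completion M. (f x)\<^sup>2 = (f' x)\<^sup>2" using f'(2) by (intro AE_completion) auto
  hence "integrable (completion M) (\<lambda>x. (f' x)\<^sup>2)"
    using integrable_cong_AE[of "\<lambda>x. (f x)\<^sup>2" "completion M" "\<lambda>x. (f' x)\<^sup>2"] f f'_c by simp
  hence "integrable M (\<lambda>x. (f' x)\<^sup>2)" using f'(1) by (subst (asm) integrable_completion) auto
  with f' that show ?thesis by (auto simp: square_integrable_def)
qed

text \<open>Here \<open>k = 0\<close> is allowed and gives the zero multi-index for every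
  \<open>i\<close>; its term is what must be removed from the Parseval series of coordinate
  \<open>i\<close>.\<close>

definition single_index :: "nat \<Rightarrow> nat \<Rightarrow> nat \<Rightarrow> nat \<Rightarrow> nat" where
  "single_index n i k = (\<lambda>j\<in>{..<n}. if j = i then k else 0)"

lemma multi_indices_single:
  "{\<alpha> \<in> multi_indices n. num_nonzero n \<alpha> = 1} = (\<Union>i\<in>{..<n}. single_index n i ` (UNIV - {0}))"
proof (intro equalityI subsetI)
  fix \<alpha> assume "\<alpha> \<in> {\<alpha> \<in> multi_indices n. num_nonzero n \<alpha> = 1}"
  hence \<alpha>: "\<alpha> \<in> {..<n} \<rightarrow>\<^sub>E UNIV" "card {j. j < n \<and> \<alpha> j \<noteq> 0} = 1"
    by (auto simp: multi_indices_def num_nonzero_def)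
  then obtain i where i: "{j. j < n \<and> \<alpha> j \<noteq> 0} = {i}" by (auto simp: card_1_singleton_iff)
  have eq: "\<alpha> = single_index n i (\<alpha> i)"
  proof
    fix j
    show "\<alpha> j = single_index n i (\<alpha> i) j"
      using \<alpha>(1) i by (cases "j < n") (auto simp: single_index_def PiE_def extensional_def)
  qed
  have "i < n" "\<alpha> i \<noteq> 0" using i by auto
  hence "single_index n i (\<alpha> i) \<in> (\<Union>i\<in>{..<n}. single_index n i ` (UNIV - {0}))"
    by (intro UN_I[of i] imageI) simp_all
  thus "\<alpha> \<in> (\<Union>i\<in>{..<n}. single_index n i ` (UNIV - {0}))" unfolding eq[symmetric] .
next
  fix \<alpha> assume "\<alpha> \<in> (\<Union>i\<in>{..<n}. single_index n i ` (UNIV - {0}))"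
  then obtain i k where ik: "i < n" "k \<noteq> 0" "\<alpha> = single_index n i k" by auto
  hence "{j. j < n \<and> \<alpha> j \<noteq> 0} = {i}" by (auto simp: single_index_def)
  thus "\<alpha> \<in> {\<alpha> \<in> multi_indices n. num_nonzero n \<alpha> = 1}"
    using ik by (auto simp: multi_indices_def num_nonzero_def single_index_def)
qed

text \<open>As \<open>\<phi> 0\<close> is \<open>1\<close> almost everywhere, only the factor at
  \<open>i\<close> survives in \<open>prod_basis\<close>; integrating out the other coordinates
  leaves the coordinate slice.\<close>

lemma fourier_coeff_single_index:
  assumes \<phi>: "orthonormal_basis unif \<phi>" and \<phi>0: "AE x in unif. \<phi> 0 x = 1"
    and f: "square_integrable (cube n) f" and f': "AE x in (\<Pi>\<^sub>M i\<in>{..<n}. unif). f x = f' x"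
      "square_integrable (\<Pi>\<^sub>M i\<in>{..<n}. unif) f'"
    and i: "i < n"
  shows "fourier_coeff \<phi> n f (single_index n i k)
    = L2_inner unif (replicas.coordinate_slice unif {..<n} f' i) (\<phi> k)"
proof -
  interpret replicas unif "{..<n}"
    by (intro replicas.intro prob_space_unif replicas_axioms.intro) simp
  have meas [measurable]: "\<phi> j \<in> borel_measurable unif" for j
    using \<phi> by (simp add: orthonormal_basis_def square_integrable_def)
  have "AE x in P {..<n}. \<forall>j\<in>{..<n}. \<phi> 0 (x j) = 1"
    by (intro AE_finite_allI AE_PiM_component prob_space_unif \<phi>0) auto
  with f'(1) have ae: "AE x in P {..<n}. f x * prod_basis \<phi> n (single_index n i k) x = f' x * \<phi> k (x i)"
  proof eventually_elim
    case x: (elim x)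
    have "prod_basis \<phi> n (single_index n i k) x = (\<Prod>j<n. if j = i then \<phi> k (x i) else 1)"
      unfolding prod_basis_def using x by (intro prod.cong) (auto simp: single_index_def)
    also have "\<dots> = \<phi> k (x i)" using i by simp
    finally show "f x * prod_basis \<phi> n (single_index n i k) x = f' x * \<phi> k (x i)" using x by simp
  qed
  have [measurable]: "f' \<in> borel_measurable (P {..<n})" using f' by (rule_tac square_integrable_measurable)
  have "fourier_coeff \<phi> n f (single_index n i k) = (LINT x|P {..<n}. f' x * \<phi> k (x i))"
    unfolding fourier_coeff_def L2_inner_def cube_def
  proof (rule integral_completion_AE[OF _ _ ae])
    have "prod_basis \<phi> n (single_index n i k) \<in> borel_measurable (P {..<n})"
      unfolding prod_basis_def by measurable
    thus "(\<lambda>x. f x * prod_basis \<phi> n (single_index n i k) x) \<in> borel_measurable (completion (P {..<n}))"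
      using square_integrable_measurable[OF f] unfolding cube_def
      by (intro borel_measurable_times) (auto intro: measurable_completion)
    show "(\<lambda>x. f' x * \<phi> k (x i)) \<in> borel_measurable (P {..<n})"
    proof (intro borel_measurable_times)
      have "(\<lambda>x. x i) \<in> P {..<n} \<rightarrow>\<^sub>M unif" using i by simp
      thus "(\<lambda>x. \<phi> k (x i)) \<in> borel_measurable (P {..<n})" using meas by (rule measurable_compose)
    qed fact
  qed
  also have "\<dots> = L2_inner unif (coordinate_slice f' i) (\<phi> k)"
    unfolding L2_inner_def
    using i by (intro integral_coordinate_slice f'(2) orthonormal_basis_square_integrable[OF \<phi>]) auto
  finally show ?thesis .
qed

theorem theorem47:
  "\<exists>C::real. C > 0 \<and>
     (\<forall>(n::nat) (\<phi> :: nat \<Rightarrow> real \<Rightarrow> real) (f :: (nat \<Rightarrow> real) \<Rightarrow> real) (g :: (nat \<Rightarrow> real) \<Rightarrow> real).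
        n \<ge> 1 \<longrightarrow>
        orthonormal_basis unif \<phi> \<longrightarrow> (AE x in unif. \<phi> 0 x = 1) \<longrightarrow>
        square_integrable (cube n) f \<longrightarrow> square_integrable (cube n) g \<longrightarrow>
        monotone_cube n f \<longrightarrow> monotone_cube n g \<longrightarrow>
        L2_norm (cube n) f \<le> 1 \<longrightarrow> L2_norm (cube n) g \<le> 1 \<longrightarrow>
        (let I = {\<alpha> \<in> multi_indices n. num_nonzero n \<alpha> = 1};
             S = (\<Sum>\<^sub>\<infinity>\<alpha>\<in>I. fourier_coeff \<phi> n f \<alpha> * fourier_coeff \<phi> n g \<alpha>)
         in (\<lambda>\<alpha>. fourier_coeff \<phi> n f \<alpha> * fourier_coeff \<phi> n g \<alpha>) summable_on I \<and>
            S \<in> {0..1} \<and>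
            (LINT x|cube n. f x * g x) - (LINT x|cube n. f x) * (LINT x|cube n. g x)
              \<ge> 1 / C * Phi S))"
proof (rule exI[of _ 61952], intro conjI allI impI)
  fix n :: nat and \<phi> :: "nat \<Rightarrow> real \<Rightarrow> real" and f g :: "(nat \<Rightarrow> real) \<Rightarrow> real"
  assume \<phi>: "orthonormal_basis unif \<phi>" and \<phi>0: "AE x in unif. \<phi> 0 x = 1"
    and f: "square_integrable (cube n) f" and g: "square_integrable (cube n) g"
    and f_mono: "monotone_cube n f" and g_mono: "monotone_cube n g"
    and f_norm: "L2_norm (cube n) f \<le> 1" and g_norm: "L2_norm (cube n) g \<le> 1"
  interpret ordered_replicas unif "{..<n}"
    by (intro ordered_replicas.intro replicas.intro prob_space_unif replicas_axioms.intro) simp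
  let ?P = "P {..<n}"
  \<comment> \<open>Monotonicity need not pass to the representatives; it stays with
    \<open>f\<close> and \<open>g\<close>, and \<open>corr_mono\<close> takes both versions.\<close>
  obtain f' where f': "square_integrable ?P f'" "AE x in ?P. f x = f' x"
    using square_integrable_completion[OF f[unfolded cube_def]] .
  obtain g' where g': "square_integrable ?P g'" "AE x in ?P. g x = g' x"
    using square_integrable_completion[OF g[unfolded cube_def]] .
  note meas = square_integrable_measurable[OF f[unfolded cube_def]]
    square_integrable_measurable[OF g[unfolded cube_def]]
    square_integrable_measurable[OF f'(1)] square_integrable_measurable[OF g'(1)]
  have Ef: "(LINT x|cube n. f x) = (LINT x|?P. f' x)" and Eg: "(LINT x|cube n. g x) = (LINT x|?P. g' x)"
    unfolding cube_def by (rule integral_completion_AE; fact)+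
  have Efg: "(LINT x|cube n. f x * g x) = (LINT x|?P. f' x * g' x)"
    unfolding cube_def using f'(2) g'(2) meas
    by (intro integral_completion_AE borel_measurable_times) auto
  have norm_le: "(LINT x|?P. (h' x)\<^sup>2) \<le> 1"
    if "L2_norm (cube n) h \<le> 1" "h \<in> borel_measurable (completion ?P)"
      "h' \<in> borel_measurable ?P" "AE x in ?P. h x = h' x" for h h' :: "(nat \<Rightarrow> real) \<Rightarrow> real"
  proof -
    have "(LINT x|completion ?P. h x * h x) = (LINT x|?P. (h' x)\<^sup>2)"
      using that(2-4) by (intro integral_completion_AE) (auto simp: power2_eq_square)
    thus ?thesis using that(1) by (simp add: L2_norm_def L2_inner_def cube_def)
  qed
  have mono: "monotone_on (space ?P) (\<lambda>x y. \<forall>i\<in>{..<n}. x i \<le> y i) (\<le>) h"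
    if "monotone_cube n h" for h :: "(nat \<Rightarrow> real) \<Rightarrow> real"
    using that space_cube[of n] by (simp add: monotone_cube_def cube_def Ball_def)
  define b where "b = corr f' g'"
  have b_mono: "b S \<le> b T" if "S \<subseteq> T" "T \<subseteq> {..<n}" for S T
    unfolding b_def by (rule corr_mono[OF f'(1) g'(1) mono[OF f_mono] f'(2) mono[OF g_mono] g'(2) that])
  have b_V: "b {..<n} = (LINT x|cube n. f x * g x)"
    unfolding b_def Efg by (rule corr_V) (fact meas)+
  have b_empty: "b {} = (LINT x|cube n. f x) * (LINT x|cube n. g x)"
    unfolding b_def Ef Eg by (rule corr_empty[OF f'(1) g'(1)])
  have sum_le: "(\<Sum>S\<in>Pow {..<n}. \<bar>subset_moebius b S\<bar>) \<le> 1"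
    unfolding b_def
    by (intro sum_abs_subset_moebius_corr_le f'(1) g'(1) norm_le[OF f_norm] norm_le[OF g_norm] meas f'(2) g'(2))
  define S where "S = (\<Sum>i<n. b {i} - b {})"
  let ?F = "\<lambda>\<alpha>. fourier_coeff \<phi> n f \<alpha> * fourier_coeff \<phi> n g \<alpha>"
  let ?I = "{\<alpha> \<in> multi_indices n. num_nonzero n \<alpha> = 1}"
  have "(?F has_sum S) ?I"
    unfolding multi_indices_single S_def
  proof (rule sum_has_sum)
    fix i assume "i \<in> {..<n}"
    hence i: "i < n" by simp
    let ?sf = "coordinate_slice f' i" and ?sg = "coordinate_slice g' i"
    have F: "?F (single_index n i k) = L2_inner unif ?sf (\<phi> k) * L2_inner unif ?sg (\<phi> k)" for k
      using fourier_coeff_single_index[OF \<phi> \<phi>0 f f'(2,1) i, of k]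
        fourier_coeff_single_index[OF \<phi> \<phi>0 g g'(2,1) i, of k] by simp
    \<comment> \<open>The coefficients at the zero multi-index are the two means.\<close>
    have F0: "?F (single_index n i 0) = b {}"
    proof -
      have "fourier_coeff \<phi> n h (single_index n i 0) = (LINT x|?P. h' x)"
        if h: "square_integrable (cube n) h" "square_integrable ?P h'" "AE x in ?P. h x = h' x" for h h'
      proof -
        have [measurable]: "\<phi> 0 \<in> borel_measurable unif"
          by (rule square_integrable_measurable[OF orthonormal_basis_square_integrable[OF \<phi>]])
        have [measurable]: "h' \<in> borel_measurable ?P" by (rule square_integrable_measurable[OF h(2)])
        have "AE x in ?P. \<phi> 0 (x i) = 1"
          using i by (intro AE_PiM_component prob_space_unif \<phi>0) auto
        hence "(LINT x|?P. h' x * \<phi> 0 (x i)) = (LINT x|?P. h' x)"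
          using i by (intro integral_cong_AE) (auto, measurable)
        thus ?thesis
          using fourier_coeff_single_index[OF \<phi> \<phi>0 h(1,3,2) i, of 0] i
            integral_coordinate_slice[OF _ h(2) orthonormal_basis_square_integrable[OF \<phi>, of 0], of i]
          by (simp add: L2_inner_def)
      qed
      from this[OF f f'] this[OF g g'] show ?thesis by (simp add: b_empty Ef Eg)
    qed
    \<comment> \<open>Parseval over all \<open>k\<close> gives \<open>b {i}\<close>, and removing
      \<open>k = 0\<close> leaves the increment \<open>b {i} - b {}\<close>.\<close>
    have "((\<lambda>k. L2_inner unif ?sf (\<phi> k) * L2_inner unif ?sg (\<phi> k)) has_sum L2_inner unif ?sf ?sg) UNIV"
      using i f' g' by (intro parseval[OF \<phi>] square_integrable_coordinate_slice) auto
    hence "((\<lambda>k. ?F (single_index n i k)) has_sum b {i}) UNIV"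
      using corr_singleton[OF _ f'(1) g'(1), of i] i by (simp add: F b_def L2_inner_def)
    hence "((\<lambda>k. ?F (single_index n i k)) has_sum (b {i} - ?F (single_index n i 0))) (UNIV - {0})"
      by (rule has_sum_Diff) (auto intro: has_sum_finiteI)
    moreover have "inj_on (single_index n i) (UNIV - {0})"
    proof (rule inj_onI)
      fix k l assume "single_index n i k = single_index n i l"
      from fun_cong[OF this, of i] i show "k = l" by (simp add: single_index_def)
    qed
    ultimately show "(?F has_sum (b {i} - b {})) (single_index n i ` (UNIV - {0}))"
      by (simp add: has_sum_reindex F0 o_def)
  next
    fix i j assume "i \<in> {..<n}" "j \<in> {..<n}" "i \<noteq> j"
    thus "single_index n i ` (UNIV - {0}) \<inter> single_index n j ` (UNIV - {0}) = {}"
      by (auto simp: single_index_def fun_eq_iff) metis+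
  qed simp
  hence sumS: "?F summable_on ?I" "infsum ?F ?I = S"
    by (auto simp: has_sum_imp_summable infsumI)
  have S01: "S \<in> {0..1}"
    using b_mono[of "{}"] level_one_le_1[OF _ sum_le] unfolding S_def by (auto intro!: sum_nonneg)
  have "1 / 61952 * Phi S \<le> b {..<n} - b {}"
    using S01 b_mono[of "{}" "{..<n}"] level_one_le[OF _ _ _ _ sum_le] b_mono
    unfolding S_def by (intro Phi_le_of_level_one_bound) auto
  thus "let I = ?I; S = infsum ?F I
        in ?F summable_on I \<and> S \<in> {0..1} \<and>
           (LINT x|cube n. f x * g x) - (LINT x|cube n. f x) * (LINT x|cube n. g x) \<ge> 1 / 61952 * Phi S"
    unfolding Let_def sumS(2) using sumS(1) S01 by (simp only: b_V b_empty)
qed simp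

end
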